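(* Let $\mu$ be a positive Borel measure on $\mathbb{C}^n$ ($n\ge 1$) such that the monomials $z^\alpha$, $\alpha\in\mathbb{N}^n$, are pairwise orthogonal in $L^2(d\mu)$ and $0<\int|z^\alpha|^2\,d\mu<\infty$ for all $\alpha\in\mathbb{N}^n$. Then the canonical solution operator $S\colon A^2_{(0,1)}(d\mu)\to L^2(d\mu)$ to $\bar\partial$ admits a diagonalization by orthonormal bases. In fact, there is a decomposition $$A^2_{(0,1)}(d\mu)=\bigoplus_{\gamma\in\Gamma}E_\gamma$$ into the mutually orthogonal finite-dimensional subspaces $E_\gamma=\operatorname{span}\{z^{\gamma+e_j}\,d\bar z_j\colon 1\le j\le n,\ \gamma+e_j\ge0\}$, which are of dimension $1$ or $n$, and there are orthonormal bases $(\varphi_{\gamma,j})_{j}$ of $E_\gamma$, such that the vectors $S\varphi_{\gamma,j}$ (over all $\gamma\in\Gamma$ and all $j$) are mutually orthogonal in $L^2(d\mu)$. For fixed $\gamma\in\Gamma$, the norms $\|S\varphi_{\gamma,j}\|$ are the square roots of the eigenvalues (with multiplicity) of the matrix $C_\gamma=(C_{\gamma,p,q})_{p,q}$ given by $$C_{\gamma,p,q}=\frac{c_{\gamma+e_p}c_{\gamma+e_q}-c_\gamma c_{\gamma+e_p+e_q}}{c_{\gamma+e_p+e_q}\sqrt{c_{\gamma+e_p}c_{\gamma+e_q}}},$$ where $p,q$ range over the indices in $\{1,\dots,n\}$ with $\gamma+e_p\ge0$, $\gamma+e_q\ge0$. In particular, $$\sum_{j}\|S\varphi_{\gamma,j}\|^2=\operatorname{trace}(C_{\gamma,p,q})_{p,q}=\sum_{p}\left(\frac{c_{\gamma+e_p}}{c_{\gamma+2e_p}}-\frac{c_\gamma}{c_{\gamma+e_p}}\right),$$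 where $j$ ranges over $1,\dots,\dim E_\gamma$ and $p$ over the indices in $\{1,\dots,n\}$ with $\gamma+e_p\ge0$.
   Context: $\mathbb{N}=\{0,1,2,\dots\}$. $A^2(d\mu)$ is the closure in $L^2(d\mu)$ of the linear span of the monomials $z^\alpha$, $\alpha\in\mathbb{N}^n$, and $c_\alpha=\left(\int|z^\alpha|^2\,d\mu\right)^{-1}$ for $\alpha\in\mathbb{N}^n$. $A^2_{(0,1)}(d\mu)$ is the Hilbert space of $(0,1)$-forms $\sum_{j=1}^n f_j\,d\bar z_j$ with $f_j\in A^2(d\mu)$, with norm squared $\sum_j\|f_j\|^2_{L^2(d\mu)}$. Multiindices: $\Gamma$ is the set of $\gamma\in\mathbb{Z}^n$ with all entries $\ge -1$ and at most one entry equal to $-1$. If $\gamma$ has an entry equal to $-1$, put $c_\gamma=0$. $e_j$ is the multiindex with $1$ in position $j$ and $0$ elsewhere; $\gamma+e_p\ge0$ means all entries of $\gamma+e_p$ are nonnegative. (So for $\gamma\in\Gamma$ either all $p\in\{1,\dots,n\}$ satisfy $\gamma+e_p\ge 0$, or exactly one $p$ does, namely the one with $\gamma_p=-1$.) Canonical solution operator: $S\omega$ is the solution $f\in L^2(d\mu)$ of $\bar\partial f=\omega$ that is orthogonal to $A^2(d\mu)$. Concretely, since $\bar\partial(\bar z_j z^\alpha)=z^\alpha d\bar z_j$, on the dense subspace of forms with polynomial coefficients (finite linear combinations of the $z^\alpha d\bar z_j$, which contains every $E_\gamma$) $S$ is the linear map for which $S(z^\alpha d\bar z_j)$ is the unique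 element of $\bar z_j z^\alpha+A^2(d\mu)$ orthogonal to $A^2(d\mu)$. "Diagonalization by orthonormal bases" means that there is an orthonormal basis of the domain space whose members are mapped by $S$ to mutually orthogonal vectors, as spelled out in the claim. *)

theory Defs
  imports
    "HOL-Analysis.Analysis"
    "HOL-Library.Function_Algebras"
    "Jordan_Normal_Form.Char_Poly"
begin

hide_const (open) Matrix.vec Matrix.unit_vec Determinant.det Matrix.row Matrix.col
hide_type (open) Matrix.vec
no_notation Matrix.vec_index (infixl "$" 100)

(* The elements of L^2(M) are represented by square integrable functions, not by their classes
   modulo null sets; identities in L^2(M) that are not stated in terms of norms or inner products
   are stated almost everywhere. *)

definition L2 :: "'a measure \<Rightarrow> ('a \<Rightarrow> complex) set" where
  "L2 M = {f \<in> borel_measurable M. integrable M (\<lambda>z. (cmod (f z))\<^sup>2)}"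

definition l2_inner :: "'a measure \<Rightarrow> ('a \<Rightarrow> complex) \<Rightarrow> ('a \<Rightarrow> complex) \<Rightarrow> complex" where
  "l2_inner M f g = (LINT z|M. f z * cnj (g z))"

definition l2_norm :: "'a measure \<Rightarrow> ('a \<Rightarrow> complex) \<Rightarrow> real" where
  "l2_norm M f = sqrt (LINT z|M. (cmod (f z))\<^sup>2)"

definition fun_scale :: "complex \<Rightarrow> ('a \<Rightarrow> complex) \<Rightarrow> 'a \<Rightarrow> complex" where
  "fun_scale c f = (\<lambda>z. c * f z)"

global_interpretation fn: vector_space "fun_scale :: complex \<Rightarrow> ('a \<Rightarrow> complex) \<Rightarrow> 'a \<Rightarrow> complex"
  by unfold_locales (auto simp: fun_scale_def fun_eq_iff algebra_simps)

(* Multiindices are vectors in int ^ 'n with the componentwise order; those in N^n are the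
   a with 0 <= a. *)

definition unit_idx :: "'n::finite \<Rightarrow> int ^ 'n" where
  "unit_idx j = axis j 1"

definition monomial :: "int ^ 'n::finite \<Rightarrow> complex ^ 'n \<Rightarrow> complex" where
  "monomial \<alpha> z = (\<Prod>j\<in>UNIV. (z $ j) powi (\<alpha> $ j))"

definition A2 :: "(complex ^ 'n::finite) measure \<Rightarrow> (complex ^ 'n \<Rightarrow> complex) set" where
  "A2 M = {f \<in> L2 M. \<forall>\<epsilon>>0. \<exists>p \<in> fn.span {monomial \<alpha> | \<alpha>. 0 \<le> \<alpha>}. l2_norm M (f - p) < \<epsilon>}"

definition cc :: "(complex ^ 'n::finite) measure \<Rightarrow> int ^ 'n \<Rightarrow> real" where
  "cc M \<gamma> = (if 0 \<le> \<gamma> then inverse (LINT z|M. (cmod (monomial \<gamma> z))\<^sup>2) else 0)"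

(* The form f_1 d\<bar>z_1 + ... + f_n d\<bar>z_n is represented by the map z |-> (f_1 z, ..., f_n z). *)

type_synonym 'n form = "complex ^ 'n \<Rightarrow> complex ^ 'n"

definition coeff_fun :: "'n::finite form \<Rightarrow> 'n \<Rightarrow> complex ^ 'n \<Rightarrow> complex" where
  "coeff_fun \<omega> j = (\<lambda>z. \<omega> z $ j)"

definition form_scale :: "complex \<Rightarrow> 'n::finite form \<Rightarrow> 'n form" where
  "form_scale c \<omega> = (\<lambda>z. c *s \<omega> z)"

global_interpretation form: vector_space "form_scale :: complex \<Rightarrow> 'n::finite form \<Rightarrow> 'n form"
  by unfold_locales (auto simp: form_scale_def fun_eq_iff vec_eq_iff algebra_simps)

definition form_inner :: "(complex ^ 'n::finite) measure \<Rightarrow> 'n form \<Rightarrow> 'n form \<Rightarrow> complex" where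
  "form_inner M \<omega> \<eta> = (\<Sum>j\<in>UNIV. l2_inner M (coeff_fun \<omega> j) (coeff_fun \<eta> j))"

definition form_norm :: "(complex ^ 'n::finite) measure \<Rightarrow> 'n form \<Rightarrow> real" where
  "form_norm M \<omega> = sqrt (\<Sum>j\<in>UNIV. (l2_norm M (coeff_fun \<omega> j))\<^sup>2)"

definition L2_form :: "(complex ^ 'n::finite) measure \<Rightarrow> 'n form set" where
  "L2_form M = {\<omega>. \<forall>j. coeff_fun \<omega> j \<in> L2 M}"

definition A2_form :: "(complex ^ 'n::finite) measure \<Rightarrow> 'n form set" where
  "A2_form M = {\<omega>. \<forall>j. coeff_fun \<omega> j \<in> A2 M}"

definition monomial_form :: "int ^ 'n::finite \<Rightarrow> 'n \<Rightarrow> 'n form" where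
  "monomial_form \<alpha> j = (\<lambda>z. axis j (monomial \<alpha> z))"

definition poly_forms :: "'n::finite form set" where
  "poly_forms = form.span {monomial_form \<alpha> j | \<alpha> j. 0 \<le> \<alpha>}"

(* S is only constrained on its dense domain, the forms with polynomial coefficients. The two
   displayed linearity conditions are equalities in L^2(M). *)

definition canonical_solution_operator ::
    "(complex ^ 'n::finite) measure \<Rightarrow> ('n form \<Rightarrow> complex ^ 'n \<Rightarrow> complex) \<Rightarrow> bool" where
  "canonical_solution_operator M S \<longleftrightarrow>
     (\<forall>\<omega>\<in>poly_forms. S \<omega> \<in> L2 M) \<and>
     (\<forall>\<omega>\<in>poly_forms. \<forall>\<eta>\<in>poly_forms. AE z in M. S (\<omega> + \<eta>) z = S \<omega> z + S \<eta> z) \<and>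
     (\<forall>\<omega>\<in>poly_forms. \<forall>c. AE z in M. S (form_scale c \<omega>) z = c * S \<omega> z) \<and>
     (\<forall>\<alpha> j. 0 \<le> \<alpha> \<longrightarrow>
        S (monomial_form \<alpha> j) - (\<lambda>z. cnj (z $ j) * monomial \<alpha> z) \<in> A2 M \<and>
        (\<forall>g\<in>A2 M. l2_inner M (S (monomial_form \<alpha> j)) g = 0))"

(* Used only for mutually orthogonal finite-dimensional subspaces V i: the set of the sums of the
   unconditionally convergent series of elements of the V i. *)

definition hilbert_sum ::
    "(complex ^ 'n::finite) measure \<Rightarrow> 'i set \<Rightarrow> ('i \<Rightarrow> 'n form set) \<Rightarrow> 'n form set" where
  "hilbert_sum M I V = {\<omega> \<in> L2_form M. \<exists>\<psi>. (\<forall>i\<in>I. \<psi> i \<in> V i) \<and>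
     ((\<lambda>F. form_norm M (\<omega> - (\<Sum>i\<in>F. \<psi> i))) \<longlongrightarrow> 0) (finite_subsets_at_top I)}"

definition orthonormal ::
    "(complex ^ 'n::finite) measure \<Rightarrow> 'i set \<Rightarrow> ('i \<Rightarrow> 'n form) \<Rightarrow> bool" where
  "orthonormal M I \<phi> \<longleftrightarrow>
     (\<forall>i\<in>I. \<forall>k\<in>I. form_inner M (\<phi> i) (\<phi> k) = (if i = k then 1 else 0))"

definition Gamma_set :: "(int ^ 'n::finite) set" where
  "Gamma_set = {\<gamma>. (\<forall>j. \<gamma> $ j \<ge> -1) \<and> card {j. \<gamma> $ j = -1} \<le> 1}"

definition idx :: "int ^ 'n::finite \<Rightarrow> 'n set" where
  "idx \<gamma> = {p. 0 \<le> \<gamma> + unit_idx p}"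

definition E_space :: "int ^ 'n::finite \<Rightarrow> 'n form set" where
  "E_space \<gamma> = form.span {monomial_form (\<gamma> + unit_idx j) j | j. j \<in> idx \<gamma>}"

(* For each gamma in Gamma_set this is a real symmetric array on idx gamma. Hence the roots of
   its real characteristic polynomial are all its eigenvalues, with their multiplicities. *)

definition C_entry :: "(complex ^ 'n::finite) measure \<Rightarrow> int ^ 'n \<Rightarrow> 'n \<Rightarrow> 'n \<Rightarrow> real" where
  "C_entry M \<gamma> p q =
     (cc M (\<gamma> + unit_idx p) * cc M (\<gamma> + unit_idx q) - cc M \<gamma> * cc M (\<gamma> + unit_idx p + unit_idx q)) /
     (cc M (\<gamma> + unit_idx p + unit_idx q) * sqrt (cc M (\<gamma> + unit_idx p) * cc M (\<gamma> + unit_idx q)))"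

(* The d x d matrix of an array A indexed by a set of size d, with respect to the enumeration
   b 0, ..., b (d - 1) of that set. *)

definition enum_mat :: "nat \<Rightarrow> (nat \<Rightarrow> 'n) \<Rightarrow> ('n \<Rightarrow> 'n \<Rightarrow> real) \<Rightarrow> real mat" where
  "enum_mat d b A = mat d d (\<lambda>(i, k). A (b i) (b k))"

end

theory Submission
  imports Defs
begin

text \<open>
  Multiplication by \<open>z\<^sub>p\<close> and by its conjugate are adjoint to each other, so for monomials
  \<open>\<langle>cnj z\<^sub>p z\<^sup>\<alpha>, z\<^sup>\<beta>\<rangle> = \<langle>z\<^sup>\<alpha>, z\<^sup>\<beta> z\<^sub>p\<rangle>\<close>, and this vanishes unless \<open>\<beta> = \<alpha> - e\<^sub>p\<close>. Hence the projection of
  \<open>cnj z\<^sub>p z\<^sup>\<alpha>\<close> to the Bergman space is a multiple of one monomial, and the canonical solution for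
  \<open>z\<^sup>\<alpha> d(cnj z\<^sub>p)\<close> is explicit: \<open>cnj z\<^sub>p z\<^sup>\<alpha> - (c (\<alpha> - e\<^sub>p) / c \<alpha>) z\<^bsup>\<alpha> - e\<^sub>p\<^esup>\<close>. The same adjointness
  computes the inner product of two such solutions. They are orthogonal unless they have the same
  index \<open>\<gamma> = \<alpha> - e\<^sub>p\<close> (\<open>l2_inner_solution\<close>), which is why the forms are grouped into the
  spaces \<open>E\<^sub>\<gamma>\<close>. Within one \<open>E\<^sub>\<gamma>\<close>, the Gram matrix of the solutions for the
  normalized forms is exactly \<open>C\<^sub>\<gamma>\<close> (\<open>C_entry_eq\<close>).

  The matrix \<open>C\<^sub>\<gamma>\<close> is real and symmetric, so it has an orthonormal basis of real
  eigenvectors (\<open>symmetric_array_eigenbasis\<close>). Rotating the basis of normalized monomial forms of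
  \<open>E\<^sub>\<gamma>\<close> by them keeps it orthonormal and diagonalizes the Gram matrix: the images under the
  solution operator become orthogonal, and their squared norms are the eigenvalues
  (\<open>eigenbasis_E_space\<close>). The eigenvalues are the roots of the characteristic polynomial because
  the matrix is similar to a diagonal one.

  Both direct sum decompositions are instances of one Hilbert space fact: if mutually orthogonal
  subspaces admit orthogonal projections, then the closure of their span consists of the sums of
  unconditionally convergent series of their elements (\<open>orth_sum_eq_closure_in\<close>). Since elements of
  \<open>L\<^sup>2\<close> are represented by functions, this is developed for inner products that are only
  positive semidefinite, and it applies to functions and to forms alike.
\<close>

hide_const (open) Matrix.orthogonal
hide_fact (open) Matrix.orthogonal_def Matrix.vec_eq_iff
no_notation Matrix.scalar_prod (infix "\<bullet>" 70)

section \<open>Spaces with a semidefinite inner product\<close>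

text \<open>
  The form \<open>ip\<close> is an inner product only on the carrier \<open>H\<close> (integrals of arbitrary functions are
  meaningless), and it may vanish on nonzero vectors, namely on functions that are zero almost
  everywhere.
\<close>

locale semi_inner_space = vector_space scale
  for scale :: "complex \<Rightarrow> 'a::ab_group_add \<Rightarrow> 'a" +
  fixes H :: "'a set" and ip :: "'a \<Rightarrow> 'a \<Rightarrow> complex"
  assumes subspace_H: "subspace H"
    and ip_add_left: "x \<in> H \<Longrightarrow> y \<in> H \<Longrightarrow> z \<in> H \<Longrightarrow> ip (x + y) z = ip x z + ip y z"
    and ip_scale_left: "x \<in> H \<Longrightarrow> y \<in> H \<Longrightarrow> ip (scale c x) y = c * ip x y"
    and ip_commute: "x \<in> H \<Longrightarrow> y \<in> H \<Longrightarrow> ip y x = cnj (ip x y)"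
    and ip_nonneg: "x \<in> H \<Longrightarrow> 0 \<le> Re (ip x x)"
begin

definition nrm :: "'a \<Rightarrow> real" where
  "nrm x = sqrt (Re (ip x x))"

definition closure_in :: "'a set \<Rightarrow> 'a set" where
  "closure_in V = {x \<in> H. \<forall>\<epsilon>>0. \<exists>p\<in>V. nrm (x - p) < \<epsilon>}"

definition orth_sum :: "'i set \<Rightarrow> ('i \<Rightarrow> 'a set) \<Rightarrow> 'a set" where
  "orth_sum I V = {x \<in> H. \<exists>\<psi>. (\<forall>i\<in>I. \<psi> i \<in> V i) \<and>
     ((\<lambda>F. nrm (x - (\<Sum>i\<in>F. \<psi> i))) \<longlongrightarrow> 0) (finite_subsets_at_top I)}"

lemmas H_closed [simp, intro] =
  subspace_0[OF subspace_H] subspace_add[OF subspace_H] subspace_diff[OF subspace_H]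
  subspace_scale[OF subspace_H] subspace_neg[OF subspace_H]

lemma sum_in_H [simp, intro]: "(\<And>i. i \<in> I \<Longrightarrow> f i \<in> H) \<Longrightarrow> (\<Sum>i\<in>I. f i) \<in> H"
  by (rule subspace_sum[OF subspace_H])

lemma span_subset_H: "B \<subseteq> H \<Longrightarrow> span B \<subseteq> H"
  by (rule span_minimal[OF _ subspace_H])

lemma ip_0_left [simp]: "x \<in> H \<Longrightarrow> ip 0 x = 0"
  using ip_scale_left[of 0 x 0] by simp

lemma ip_minus_left: "x \<in> H \<Longrightarrow> y \<in> H \<Longrightarrow> ip (- x) y = - ip x y"
  using ip_scale_left[of x y "-1"] by simp

lemma ip_diff_left: "x \<in> H \<Longrightarrow> y \<in> H \<Longrightarrow> z \<in> H \<Longrightarrow> ip (x - y) z = ip x z - ip y z"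
  using ip_add_left[of x "- y" z] by (simp add: ip_minus_left)

lemma ip_sum_left:
  "(\<And>i. i \<in> I \<Longrightarrow> f i \<in> H) \<Longrightarrow> y \<in> H \<Longrightarrow> ip (\<Sum>i\<in>I. f i) y = (\<Sum>i\<in>I. ip (f i) y)"
  by (induction I rule: infinite_finite_induct) (auto simp: ip_add_left)

lemma ip_0_right [simp]: "x \<in> H \<Longrightarrow> ip x 0 = 0"
  using ip_commute[of 0 x] by simp

lemma ip_add_right: "x \<in> H \<Longrightarrow> y \<in> H \<Longrightarrow> z \<in> H \<Longrightarrow> ip x (y + z) = ip x y + ip x z"
  using ip_commute[of "y + z" x] ip_commute[of y x] ip_commute[of z x] by (simp add: ip_add_left)

lemma ip_scale_right: "x \<in> H \<Longrightarrow> y \<in> H \<Longrightarrow> ip x (scale c y) = cnj c * ip x y"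
  using ip_commute[of "scale c y" x] ip_commute[of y x] by (simp add: ip_scale_left)

lemma ip_diff_right: "x \<in> H \<Longrightarrow> y \<in> H \<Longrightarrow> z \<in> H \<Longrightarrow> ip x (y - z) = ip x y - ip x z"
  using ip_commute[of "y - z" x] ip_commute[of y x] ip_commute[of z x] by (simp add: ip_diff_left)

lemma ip_sum_right:
  "(\<And>i. i \<in> I \<Longrightarrow> f i \<in> H) \<Longrightarrow> x \<in> H \<Longrightarrow> ip x (\<Sum>i\<in>I. f i) = (\<Sum>i\<in>I. ip x (f i))"
  by (induction I rule: infinite_finite_induct) (auto simp: ip_add_right)

lemma ip_lincomb:
  assumes "\<And>i. i \<in> I \<Longrightarrow> f i \<in> H" "\<And>k. k \<in> K \<Longrightarrow> g k \<in> H"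
  shows "ip (\<Sum>i\<in>I. scale (a i) (f i)) (\<Sum>k\<in>K. scale (b k) (g k)) =
    (\<Sum>i\<in>I. \<Sum>k\<in>K. a i * cnj (b k) * ip (f i) (g k))"
proof -
  have "ip (\<Sum>i\<in>I. scale (a i) (f i)) (\<Sum>k\<in>K. scale (b k) (g k)) =
      (\<Sum>i\<in>I. \<Sum>k\<in>K. ip (scale (a i) (f i)) (scale (b k) (g k)))"
    using assms by (subst ip_sum_left) (auto intro!: sum.cong ip_sum_right)
  also have "\<dots> = (\<Sum>i\<in>I. \<Sum>k\<in>K. a i * cnj (b k) * ip (f i) (g k))"
    using assms by (intro sum.cong) (auto simp: ip_scale_left ip_scale_right)
  finally show ?thesis .
qed

lemma nrm_nonneg [simp]: "x \<in> H \<Longrightarrow> 0 \<le> nrm x"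
  by (simp add: nrm_def ip_nonneg)

lemma nrm_sq: "x \<in> H \<Longrightarrow> (nrm x)\<^sup>2 = Re (ip x x)"
  by (simp add: nrm_def ip_nonneg)

lemma nrm_0 [simp]: "nrm 0 = 0"
  using ip_0_left[of 0] by (simp add: nrm_def)

lemma nrm_scale: "x \<in> H \<Longrightarrow> nrm (scale c x) = cmod c * nrm x"
proof -
  assume x: "x \<in> H"
  have "ip (scale c x) (scale c x) = (c * cnj c) * ip x x"
    using x by (simp add: ip_scale_left ip_scale_right)
  also have "c * cnj c = of_real ((cmod c)\<^sup>2)" by (rule complex_norm_square[symmetric])
  finally have "Re (ip (scale c x) (scale c x)) = (cmod c)\<^sup>2 * Re (ip x x)"
    by (simp del: of_real_power)
  then show ?thesis
    by (simp add: nrm_def real_sqrt_mult)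
qed

lemma nrm_sq_add:
  "x \<in> H \<Longrightarrow> y \<in> H \<Longrightarrow> (nrm (x + y))\<^sup>2 = (nrm x)\<^sup>2 + 2 * Re (ip x y) + (nrm y)\<^sup>2"
  using ip_commute[of x y] by (simp add: nrm_sq ip_add_left ip_add_right)

lemma cauchy_schwarz:
  assumes x: "x \<in> H" and y: "y \<in> H"
  shows "cmod (ip x y) \<le> nrm x * nrm y"
proof -
  define a where "a = ip x y"
  have *: "0 \<le> (nrm x)\<^sup>2 - 2 * s * (cmod a)\<^sup>2 + s\<^sup>2 * (cmod a)\<^sup>2 * (nrm y)\<^sup>2" for s :: real
  proof -
    define y' where "y' = scale (- of_real s * a) y"
    have y': "y' \<in> H" unfolding y'_def using y by auto
    have "ip x y' = of_real (- s) * (a * cnj a)"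
      unfolding y'_def ip_scale_right[OF x y] a_def[symmetric] by simp
    also have "a * cnj a = of_real ((cmod a)\<^sup>2)" by (rule complex_norm_square[symmetric])
    finally have 1: "Re (ip x y') = - s * (cmod a)\<^sup>2" by (simp del: of_real_power)
    have 2: "(nrm y')\<^sup>2 = s\<^sup>2 * (cmod a)\<^sup>2 * (nrm y)\<^sup>2"
      unfolding y'_def nrm_scale[OF y] by (simp add: norm_mult power_mult_distrib)
    have "0 \<le> (nrm (x + y'))\<^sup>2" by simp
    also have "\<dots> = (nrm x)\<^sup>2 - 2 * s * (cmod a)\<^sup>2 + s\<^sup>2 * (cmod a)\<^sup>2 * (nrm y)\<^sup>2"
      unfolding nrm_sq_add[OF x y'] 1 2 by simp
    finally show ?thesis .
  qed
  have "(cmod a)\<^sup>2 \<le> (nrm x)\<^sup>2 * (nrm y)\<^sup>2"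
  proof (cases "nrm y = 0")
    case True
    \<comment> \<open>If \<open>y\<close> is a null vector, the quadratic polynomial in \<open>s\<close> is affine, and it becomes negative for
      large \<open>s\<close> unless its slope is zero.\<close>
    have "a = 0"
    proof (rule ccontr)
      assume "a \<noteq> 0"
      then show False using *[of "((nrm x)\<^sup>2 + 1) / (2 * (cmod a)\<^sup>2)"] True by simp
    qed
    then show ?thesis by simp
  next
    case False
    have "0 \<le> (nrm x)\<^sup>2 - (cmod a)\<^sup>2 / (nrm y)\<^sup>2"
      using *[of "1 / (nrm y)\<^sup>2"] False by (simp add: power2_eq_square)
    then show ?thesis using False by (simp add: pos_divide_le_eq)
  qed
  then have "(cmod a)\<^sup>2 \<le> (nrm x * nrm y)\<^sup>2" by (simp add: power_mult_distrib)
  then show ?thesis using x y by (simp add: a_def abs_le_square_iff[symmetric] abs_mult)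
qed

lemma nrm_triangle:
  assumes "x \<in> H" "y \<in> H"
  shows "nrm (x + y) \<le> nrm x + nrm y"
proof (rule power2_le_imp_le)
  have "Re (ip x y) \<le> nrm x * nrm y"
    using cauchy_schwarz[OF assms] complex_Re_le_cmod[of "ip x y"] by linarith
  then show "(nrm (x + y))\<^sup>2 \<le> (nrm x + nrm y)\<^sup>2"
    using assms by (simp add: nrm_sq_add power2_sum)
qed (use assms in simp)

lemma closure_inD: "x \<in> closure_in V \<Longrightarrow> 0 < \<epsilon> \<Longrightarrow> \<exists>p\<in>V. nrm (x - p) < \<epsilon>"
  by (simp add: closure_in_def)

lemma closure_in_superset: "V \<subseteq> H \<Longrightarrow> V \<subseteq> closure_in V"
  by (force simp: closure_in_def)

lemma subspace_closure_in:
  assumes V: "subspace V" "V \<subseteq> H"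
  shows "subspace (closure_in V)"
proof (rule subspaceI)
  show "0 \<in> closure_in V"
    using closure_in_superset[OF V(2)] subspace_0[OF V(1)] by auto
next
  fix x y assume xy: "x \<in> closure_in V" "y \<in> closure_in V"
  have "\<exists>p\<in>V. nrm (x + y - p) < \<epsilon>" if \<epsilon>: "\<epsilon> > 0" for \<epsilon>
  proof -
    obtain p q where pq: "p \<in> V" "nrm (x - p) < \<epsilon> / 2" "q \<in> V" "nrm (y - q) < \<epsilon> / 2"
      using closure_inD[OF xy(1), of "\<epsilon> / 2"] closure_inD[OF xy(2), of "\<epsilon> / 2"] \<epsilon> by auto
    have "nrm ((x - p) + (y - q)) \<le> nrm (x - p) + nrm (y - q)"
      using pq V xy by (intro nrm_triangle) (auto simp: closure_in_def)
    then have "nrm ((x - p) + (y - q)) < \<epsilon>" using pq by linarith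
    moreover have "x + y - (p + q) = (x - p) + (y - q)" by (simp add: algebra_simps)
    ultimately have "nrm (x + y - (p + q)) < \<epsilon>" by (simp only:)
    then show ?thesis using subspace_add[OF V(1) pq(1,3)] by blast
  qed
  then show "x + y \<in> closure_in V" using xy by (auto simp: closure_in_def)
next
  fix c x assume x: "x \<in> closure_in V"
  have "\<exists>p\<in>V. nrm (scale c x - p) < \<epsilon>" if \<epsilon>: "\<epsilon> > 0" for \<epsilon>
  proof -
    obtain p where p: "p \<in> V" "nrm (x - p) < \<epsilon> / (cmod c + 1)"
      using closure_inD[OF x, of "\<epsilon> / (cmod c + 1)"] \<epsilon> by (auto simp: add_nonneg_pos)
    have xp: "x - p \<in> H" using x p V by (auto simp: closure_in_def)
    have "nrm (scale c (x - p)) \<le> (cmod c + 1) * nrm (x - p)"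
      using xp by (simp add: nrm_scale mult_right_mono)
    also have "\<dots> < \<epsilon>"
      using p(2) by (simp add: pos_less_divide_eq add_nonneg_pos mult.commute)
    finally show ?thesis
      using subspace_scale[OF V(1) p(1)] by (intro bexI[of _ "scale c p"])
        (auto simp: scale_right_diff_distrib)
  qed
  then show "scale c x \<in> closure_in V" using x by (auto simp: closure_in_def)
qed

lemma orth_span:
  assumes "x \<in> H" "B \<subseteq> H" "\<And>b. b \<in> B \<Longrightarrow> ip x b = 0" "v \<in> span B"
  shows "ip x v = 0"
proof -
  have "subspace {v \<in> H. ip x v = 0}"
    using assms(1) by (auto intro!: subspaceI simp: ip_add_right ip_scale_right)
  then have "span B \<subseteq> {v \<in> H. ip x v = 0}"
    using assms(2,3) by (intro span_minimal) auto
  then show ?thesis using assms(4) by auto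
qed

lemma orth_span_span:
  assumes "A \<subseteq> H" "B \<subseteq> H" "\<And>a b. a \<in> A \<Longrightarrow> b \<in> B \<Longrightarrow> ip a b = 0"
    and x: "x \<in> span A" and y: "y \<in> span B"
  shows "ip x y = 0"
proof -
  have H: "x \<in> H" "y \<in> H" using assms span_subset_H by blast+
  have "ip y a = 0" if a: "a \<in> A" for a
  proof -
    have "a \<in> H" using a assms(1) by auto
    then have "ip a y = 0" using orth_span[of a B y] assms a by blast
    then show ?thesis using ip_commute[of a y] \<open>a \<in> H\<close> H by simp
  qed
  then have "ip y x = 0" using orth_span[of y A x] assms(1) x H by blast
  then show ?thesis using ip_commute[of y x] H by simp
qed

lemma orth_closure_in:
  assumes x: "x \<in> H" and V: "V \<subseteq> H" "\<And>v. v \<in> V \<Longrightarrow> ip x v = 0" and y: "y \<in> closure_in V"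
  shows "ip x y = 0"
proof -
  have "cmod (ip x y) \<le> 0 + \<epsilon>" if \<epsilon>: "\<epsilon> > 0" for \<epsilon>
  proof -
    obtain p where p: "p \<in> V" "nrm (y - p) < \<epsilon> / (nrm x + 1)"
      using closure_inD[OF y, of "\<epsilon> / (nrm x + 1)"] \<epsilon> x by (auto simp: add_nonneg_pos)
    have H: "y \<in> H" "p \<in> H" using y p V by (auto simp: closure_in_def)
    have "cmod (ip x y) = cmod (ip x (y - p))"
      using x H p V by (simp add: ip_diff_right)
    also have "\<dots> \<le> nrm x * nrm (y - p)" using x H by (intro cauchy_schwarz) auto
    also have "\<dots> \<le> (nrm x + 1) * nrm (y - p)" using H by (intro mult_right_mono) auto
    also have "\<dots> \<le> \<epsilon>"
      using p(2) nrm_nonneg[OF x] by (simp add: pos_less_divide_eq mult.commute less_imp_le)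
    finally show ?thesis by simp
  qed
  then have "cmod (ip x y) \<le> 0" by (rule field_le_epsilon)
  then show ?thesis by simp
qed

lemma independent_orthogonal:
  assumes "B \<subseteq> H" and "\<And>x y. x \<in> B \<Longrightarrow> y \<in> B \<Longrightarrow> x \<noteq> y \<Longrightarrow> ip x y = 0"
    and "\<And>x. x \<in> B \<Longrightarrow> ip x x \<noteq> 0"
  shows "independent B"
proof -
  have "x \<notin> span (B - {x})" if "x \<in> B" for x
    using orth_span[of x "B - {x}" x] assms that by blast
  then show ?thesis by (auto simp: dependent_def)
qed

text \<open>
  The carrier need not be complete, so orthogonal projections are constructed only onto spans of finite
  orthonormal families, as Fourier sums.
\<close>

lemma orthonormal_projection:
  assumes J: "finite J" and \<phi>: "\<And>j. j \<in> J \<Longrightarrow> \<phi> j \<in> H"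
    and on: "\<And>j k. j \<in> J \<Longrightarrow> k \<in> J \<Longrightarrow> ip (\<phi> j) (\<phi> k) = (if j = k then 1 else 0)"
    and x: "x \<in> H"
  shows "\<exists>p\<in>span (\<phi> ` J). \<forall>v\<in>span (\<phi> ` J). ip (x - p) v = 0"
proof (intro bexI ballI)
  define p where "p = (\<Sum>j\<in>J. scale (ip x (\<phi> j)) (\<phi> j))"
  show "p \<in> span (\<phi> ` J)"
    unfolding p_def by (intro span_sum span_scale span_base) auto
  have pH: "p \<in> H" unfolding p_def using \<phi> by auto
  have "ip (x - p) (\<phi> k) = 0" if k: "k \<in> J" for k
  proof -
    have "ip p (\<phi> k) = (\<Sum>j\<in>J. ip x (\<phi> j) * (if j = k then 1 else 0))"
      unfolding p_def using \<phi> k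
      by (subst ip_sum_left) (auto simp: ip_scale_left on intro!: sum.cong)
    also have "\<dots> = ip x (\<phi> k)" using J k by (simp add: if_distrib sum.delta cong: if_cong)
    finally show ?thesis using x pH \<phi>[OF k] by (simp add: ip_diff_left)
  qed
  then have "ip (x - p) b = 0" if "b \<in> \<phi> ` J" for b using that by blast
  moreover have "x - p \<in> H" "\<phi> ` J \<subseteq> H" using x pH \<phi> by auto
  ultimately show "ip (x - p) v = 0" if "v \<in> span (\<phi> ` J)" for v
    using that by (metis orth_span)
qed

lemma span_UN_finite_sum:
  assumes V: "\<And>i. i \<in> I \<Longrightarrow> subspace (V i)" and x: "x \<in> span (\<Union>i\<in>I. V i)"
  shows "\<exists>F v. finite F \<and> F \<subseteq> I \<and> (\<forall>i\<in>F. v i \<in> V i) \<and> x = (\<Sum>i\<in>F. v i)"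
  using x
proof (induction rule: span_induct_alt)
  case base
  show ?case by (intro exI[of _ "{}"]) auto
next
  case (step c b y)
  then obtain i F v where i: "i \<in> I" "b \<in> V i"
    and F: "finite F" "F \<subseteq> I" "\<forall>i\<in>F. v i \<in> V i" "y = (\<Sum>i\<in>F. v i)" by auto
  define w where "w k = (if k \<in> F then v k else 0) + (if k = i then scale c b else 0)" for k
  have "(\<Sum>k\<in>insert i F. w k) = (\<Sum>k\<in>insert i F. if k \<in> F then v k else 0) + scale c b"
    using F(1) by (simp add: w_def sum.distrib sum.delta)
  also have "(\<Sum>k\<in>insert i F. if k \<in> F then v k else 0) = y"
    unfolding F(4) using F(1) by (intro sum.mono_neutral_cong_right) auto
  finally have "scale c b + y = (\<Sum>k\<in>insert i F. w k)" by simp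
  moreover have "\<forall>k\<in>insert i F. w k \<in> V k"
    using F i V by (auto simp: w_def subset_iff intro!: subspace_add subspace_scale subspace_0)
  ultimately show ?case
    using F i by (intro exI[of _ "insert i F"] exI[of _ w]) auto
qed

text \<open>
  The terms of the series are the orthogonal projections of \<open>x\<close> to the \<open>V i\<close>. The partial sum over a
  finite set \<open>F\<close> is then the best approximation of \<open>x\<close> by sums of elements of the \<open>V i\<close> with \<open>i\<close> in
  \<open>F\<close>, so it is at least as good as any given approximation whose indices lie in \<open>F\<close>.
\<close>

theorem orth_sum_eq_closure_in:
  assumes V: "\<And>i. i \<in> I \<Longrightarrow> subspace (V i)" "\<And>i. i \<in> I \<Longrightarrow> V i \<subseteq> H"
    and orth: "\<And>i k x y. i \<in> I \<Longrightarrow> k \<in> I \<Longrightarrow> i \<noteq> k \<Longrightarrow> x \<in> V i \<Longrightarrow> y \<in> V k \<Longrightarrow> ip x y = 0"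
    and proj: "\<And>i x. i \<in> I \<Longrightarrow> x \<in> H \<Longrightarrow> \<exists>p\<in>V i. \<forall>v\<in>V i. ip (x - p) v = 0"
  shows "orth_sum I V = closure_in (span (\<Union>i\<in>I. V i))"
proof (intro equalityI subsetI)
  fix x assume "x \<in> orth_sum I V"
  then obtain \<psi> where x: "x \<in> H" and \<psi>: "\<forall>i\<in>I. \<psi> i \<in> V i"
    and lim: "((\<lambda>F. nrm (x - (\<Sum>i\<in>F. \<psi> i))) \<longlongrightarrow> 0) (finite_subsets_at_top I)"
    by (auto simp: orth_sum_def)
  have "\<exists>p\<in>span (\<Union>i\<in>I. V i). nrm (x - p) < \<epsilon>" if \<epsilon>: "\<epsilon> > 0" for \<epsilon>
  proof -
    have "eventually (\<lambda>F. nrm (x - (\<Sum>i\<in>F. \<psi> i)) < \<epsilon>) (finite_subsets_at_top I)"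
      using order_tendstoD(2)[OF lim \<epsilon>] .
    then obtain F where F: "F \<subseteq> I" "nrm (x - (\<Sum>i\<in>F. \<psi> i)) < \<epsilon>"
      unfolding eventually_finite_subsets_at_top by blast
    have "(\<Sum>i\<in>F. \<psi> i) \<in> span (\<Union>i\<in>I. V i)"
      using F \<psi> by (intro span_sum span_base) auto
    then show ?thesis using F by auto
  qed
  then show "x \<in> closure_in (span (\<Union>i\<in>I. V i))" using x by (simp add: closure_in_def)
next
  fix x assume x: "x \<in> closure_in (span (\<Union>i\<in>I. V i))"
  then have xH: "x \<in> H" by (simp add: closure_in_def)
  have "\<forall>i\<in>I. \<exists>p\<in>V i. \<forall>v\<in>V i. ip (x - p) v = 0" using proj xH by blast
  then obtain \<psi> where \<psi>: "\<And>i. i \<in> I \<Longrightarrow> \<psi> i \<in> V i"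
    and \<psi>_orth: "\<And>i v. i \<in> I \<Longrightarrow> v \<in> V i \<Longrightarrow> ip (x - \<psi> i) v = 0" by metis
  have \<psi>H: "\<psi> i \<in> H" if "i \<in> I" for i using \<psi> V(2) that by auto
  \<comment> \<open>The difference of the partial sum and \<open>p\<close> is orthogonal to the remainder, so Pythagoras applies.\<close>
  have best: "nrm (x - (\<Sum>i\<in>F. \<psi> i)) \<le> nrm (x - p)"
    if F: "finite F" "F0 \<subseteq> F" "F \<subseteq> I" and v: "\<forall>i\<in>F0. v i \<in> V i" and p: "p = (\<Sum>i\<in>F0. v i)"
    for F F0 v p
  proof -
    define y where "y = (\<Sum>i\<in>F. \<psi> i)"
    have H: "y \<in> H" "p \<in> H" unfolding y_def p using F \<psi>H v V(2) by blast+
    have orth_V: "ip (x - y) u = 0" if k: "k \<in> F" and u: "u \<in> V k" for k u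
    proof -
      have uH: "u \<in> H" and kI: "k \<in> I" using F k u V(2) by auto
      have "ip y u = (\<Sum>i\<in>F. ip (\<psi> i) u)"
        unfolding y_def using F \<psi>H uH by (intro ip_sum_left) auto
      also have "\<dots> = (\<Sum>i\<in>F. if i = k then ip (\<psi> k) u else 0)"
      proof (intro sum.cong refl)
        fix i assume "i \<in> F"
        then show "ip (\<psi> i) u = (if i = k then ip (\<psi> k) u else 0)"
          using orth[of i k "\<psi> i" u] F \<psi> k u kI by auto
      qed
      also have "\<dots> = ip x u"
        using F(1) k \<psi>_orth[OF kI u] \<psi>H[OF kI] uH xH by (simp add: ip_diff_left)
      finally show ?thesis using H xH uH by (simp add: ip_diff_left)
    qed
    have "ip (x - y) y = (\<Sum>i\<in>F. ip (x - y) (\<psi> i))"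
      using F \<psi>H H xH by (subst (2) y_def, intro ip_sum_right) auto
    then have 1: "ip (x - y) y = 0" using F \<psi> orth_V by (auto intro!: sum.neutral)
    have "ip (x - y) p = (\<Sum>i\<in>F0. ip (x - y) (v i))"
      unfolding p using F v V(2) H xH by (intro ip_sum_right) blast+
    then have 2: "ip (x - y) p = 0" using F v orth_V by (auto intro!: sum.neutral)
    have "ip (x - y) (y - p) = 0" using 1 2 H xH by (simp add: ip_diff_right)
    then have "(nrm ((x - y) + (y - p)))\<^sup>2 = (nrm (x - y))\<^sup>2 + (nrm (y - p))\<^sup>2"
      using H xH by (subst nrm_sq_add) auto
    then have "(nrm (x - y))\<^sup>2 \<le> (nrm (x - p))\<^sup>2" by simp
    then show ?thesis unfolding y_def[symmetric] using H xH by (auto intro: power2_le_imp_le)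
  qed
  have "((\<lambda>F. nrm (x - (\<Sum>i\<in>F. \<psi> i))) \<longlongrightarrow> 0) (finite_subsets_at_top I)"
  proof (rule order_tendstoI)
    fix a :: real assume "a < 0"
    moreover have "0 \<le> nrm (x - (\<Sum>i\<in>F. \<psi> i))" if "F \<subseteq> I" for F
    proof -
      have "x - (\<Sum>i\<in>F. \<psi> i) \<in> H" using that \<psi>H xH by blast
      then show ?thesis by simp
    qed
    ultimately show "\<forall>\<^sub>F F in finite_subsets_at_top I. a < nrm (x - (\<Sum>i\<in>F. \<psi> i))"
      unfolding eventually_finite_subsets_at_top
      by (intro exI[of _ "{}"] conjI allI impI) (auto intro: less_le_trans)
  next
    fix \<epsilon> :: real assume "0 < \<epsilon>"
    then obtain p where p: "p \<in> span (\<Union>i\<in>I. V i)" "nrm (x - p) < \<epsilon>"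
      using x by (auto simp: closure_in_def)
    from span_UN_finite_sum[of I V, OF V(1) p(1)] obtain F0 v where
      F0: "finite F0" "F0 \<subseteq> I" "\<forall>i\<in>F0. v i \<in> V i" "p = (\<Sum>i\<in>F0. v i)" by auto
    have "nrm (x - (\<Sum>i\<in>F. \<psi> i)) < \<epsilon>" if "finite F" "F0 \<subseteq> F" "F \<subseteq> I" for F
      using best[OF that F0(3,4)] p(2) by simp
    then show "\<forall>\<^sub>F F in finite_subsets_at_top I. nrm (x - (\<Sum>i\<in>F. \<psi> i)) < \<epsilon>"
      unfolding eventually_finite_subsets_at_top using F0 by blast
  qed
  then show "x \<in> orth_sum I V" using xH \<psi> by (auto simp: orth_sum_def)
qed

end

section \<open>The spectral theorem for real symmetric arrays\<close>

text \<open>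
  The quadratic form of \<open>f\<close> attains its maximum \<open>\<mu>\<close> over the unit sphere of \<open>S\<close> at some \<open>v\<close>. Then
  \<open>\<mu> (x \<bullet> y) - x \<bullet> f y\<close> is a positive semidefinite form on \<open>S\<close> that vanishes at \<open>v\<close>, and such a form
  vanishes at all pairs \<open>(v, w)\<close>.
\<close>

lemma selfadjoint_has_eigenvector:
  fixes f :: "'a::euclidean_space \<Rightarrow> 'a"
  assumes f: "linear f" and sym: "\<And>x y. x \<bullet> f y = f x \<bullet> y"
    and S: "subspace S" "f ` S \<subseteq> S" "S \<noteq> {0}"
  shows "\<exists>v\<in>S. norm v = 1 \<and> f v = (v \<bullet> f v) *\<^sub>R v"
proof -
  define T where "T = S \<inter> sphere 0 1"
  have "compact T"
    unfolding T_def using closed_subspace[OF S(1)] by (intro closed_Int_compact) auto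
  moreover obtain w where w: "w \<in> S" "w \<noteq> 0" using S subspace_0[OF S(1)] by blast
  have "w /\<^sub>R norm w \<in> T" using w S(1) by (simp add: T_def subspace_scale)
  then have "T \<noteq> {}" by blast
  moreover have "continuous_on T (\<lambda>x. x \<bullet> f x)"
    using linear_continuous_on[of f T] f by (intro continuous_intros) (simp add: linear_conv_bounded_linear)
  ultimately obtain v where v: "v \<in> T" "\<And>x. x \<in> T \<Longrightarrow> x \<bullet> f x \<le> v \<bullet> f v"
    using continuous_attains_sup[of T "\<lambda>x. x \<bullet> f x"] by auto
  have vS: "v \<in> S" and nv: "norm v = 1" using v(1) by (auto simp: T_def)
  define \<mu> where "\<mu> = v \<bullet> f v"
  have quad: "x \<bullet> f x \<le> \<mu> * (x \<bullet> x)" if "x \<in> S" for x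
  proof (cases "x = 0")
    case False
    have "x /\<^sub>R norm x \<in> T" using that False S(1) by (simp add: T_def subspace_scale)
    from v(2)[OF this] have "x \<bullet> f x / (norm x * norm x) \<le> \<mu>"
      by (simp add: \<mu>_def linear_scale[OF f] divide_inverse_commute mult.commute mult.left_commute)
    then show ?thesis using False
      by (simp add: pos_divide_le_eq mult_pos_pos dot_square_norm power2_eq_square)
  qed (simp add: linear_0[OF f])
  \<comment> \<open>Perturbing \<open>v\<close> in the direction of the defect \<open>w\<close> of the eigenvalue equation gives a quadratic
    polynomial in \<open>t\<close> that has no constant term and is nowhere negative; its linear coefficient
    is a multiple of the squared norm of \<open>w\<close>.\<close>
  define w where "w = \<mu> *\<^sub>R v - f v"
  have wS: "w \<in> S" unfolding w_def using S vS by (auto intro!: subspace_diff subspace_scale)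
  define a where "a = w \<bullet> w"
  define b where "b = \<mu> * (w \<bullet> w) - w \<bullet> f w"
  have b: "0 \<le> b" using quad[OF wS] by (simp add: b_def)
  have "0 \<le> 2 * t * a + t\<^sup>2 * b" for t :: real
  proof -
    have "v + t *\<^sub>R w \<in> S" using S(1) vS wS by (intro subspace_add subspace_scale)
    from quad[OF this] have "0 \<le> \<mu> * ((v + t *\<^sub>R w) \<bullet> (v + t *\<^sub>R w)) - (v + t *\<^sub>R w) \<bullet> f (v + t *\<^sub>R w)"
      by simp
    also have "\<dots> = (\<mu> * (v \<bullet> v) - v \<bullet> f v) + 2 * t * (\<mu> * (w \<bullet> v) - w \<bullet> f v) + t\<^sup>2 * b"
      using sym[of v w] unfolding b_def
      by (simp add: linear_add[OF f] linear_scale[OF f] inner_add_left inner_add_right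
          inner_commute[of v w] inner_commute[of "f v" w] power2_eq_square algebra_simps)
    also have "\<mu> * (v \<bullet> v) - v \<bullet> f v = 0" using nv by (simp add: \<mu>_def dot_square_norm)
    also have "\<mu> * (w \<bullet> v) - w \<bullet> f v = a" by (simp add: a_def w_def inner_diff_right)
    finally show ?thesis by simp
  qed
  \<comment> \<open>The minimum is near \<open>- a / b\<close>; the shifted denominator also covers \<open>b = 0\<close>.\<close>
  from this[of "- a / (b + 1)"] have "0 \<le> 2 * (- a / (b + 1)) * a + (- a / (b + 1))\<^sup>2 * b" .
  also have "\<dots> = - (a\<^sup>2 * (b + 2)) / (b + 1)\<^sup>2"
  proof -
    have "b + 1 \<noteq> 0" using b by simp
    then show ?thesis by (simp add: divide_simps) (simp add: algebra_simps power2_eq_square)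
  qed
  finally have "0 \<le> - (a\<^sup>2 * (b + 2)) / (b + 1)\<^sup>2" .
  moreover have "0 < (b + 1)\<^sup>2" using b by simp
  ultimately have "a\<^sup>2 * (b + 2) \<le> 0" by (simp add: divide_le_0_iff)
  then have "a = 0" using b by (smt (verit) mult_pos_pos zero_less_power2)
  then have "f v = \<mu> *\<^sub>R v" by (simp add: a_def w_def)
  then show ?thesis using vS nv \<mu>_def by blast
qed

text \<open>
  The orthogonal complement of an eigenvector in \<open>S\<close> is again invariant, so eigenvectors can be split
  off one at a time.
\<close>

lemma selfadjoint_eigenbasis:
  fixes f :: "'a::euclidean_space \<Rightarrow> 'a"
  assumes f: "linear f" and sym: "\<And>x y. x \<bullet> f y = f x \<bullet> y"
    and "subspace S" "f ` S \<subseteq> S"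
  shows "\<exists>B. finite B \<and> pairwise orthogonal B \<and> (\<forall>b\<in>B. norm b = 1) \<and> span B = S \<and>
    (\<forall>b\<in>B. f b = (b \<bullet> f b) *\<^sub>R b)"
  using assms(3,4)
proof (induction "dim S" arbitrary: S rule: less_induct)
  case less
  show ?case
  proof (cases "S = {0}")
    case True
    then show ?thesis by (intro exI[of _ "{}"]) auto
  next
    case False
    obtain v where v: "v \<in> S" "norm v = 1" "f v = (v \<bullet> f v) *\<^sub>R v"
      using selfadjoint_has_eigenvector[OF f sym less.prems False] by blast
    define S' where "S' = {x \<in> S. v \<bullet> x = 0}"
    have S': "subspace S'" using less.prems(1)
      by (auto simp: S'_def subspace_def inner_add_right)
    have fS': "f ` S' \<subseteq> S'"
    proof
      fix y assume "y \<in> f ` S'"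
      then obtain x where x: "y = f x" "x \<in> S" "v \<bullet> x = 0" by (auto simp: S'_def)
      have "v \<bullet> f x = (v \<bullet> f v) * (v \<bullet> x)" using arg_cong[OF v(3), of "\<lambda>y. y \<bullet> x"] by (simp add: sym)
      then show "y \<in> S'" using x less.prems(2) by (auto simp: S'_def)
    qed
    have "v \<notin> S'" using v(2) by (auto simp: S'_def)
    moreover have "S' \<subseteq> S" by (auto simp: S'_def)
    ultimately have "S' \<subset> S" using v(1) by blast
    then have "dim S' < dim S"
      using S' less.prems(1) by (intro dim_psubset) (simp add: span_eq_iff[THEN iffD2])
    then obtain B where B: "finite B" "pairwise orthogonal B" "\<forall>b\<in>B. norm b = 1"
      "span B = S'" "\<forall>b\<in>B. f b = (b \<bullet> f b) *\<^sub>R b"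
      using less.hyps[of S'] S' fS' by blast
    have BS': "B \<subseteq> S'" using B(4) span_superset by blast
    have "pairwise orthogonal (insert v B)"
      using B(2) BS' by (auto simp: pairwise_insert orthogonal_def S'_def inner_commute)
    moreover have "span (insert v B) = S"
    proof (intro equalityI subsetI)
      show "x \<in> S" if "x \<in> span (insert v B)" for x
        using span_minimal[of "insert v B" S] BS' v(1) less.prems(1) that by (auto simp: S'_def)
      fix x assume x: "x \<in> S"
      have "x - (v \<bullet> x) *\<^sub>R v \<in> S'"
        using x v less.prems(1)
        by (auto simp: S'_def inner_diff_right dot_square_norm intro!: subspace_diff subspace_scale)
      then have "x - (v \<bullet> x) *\<^sub>R v \<in> span (insert v B)" using B(4) span_mono[of B "insert v B"] by blast
      moreover have "(v \<bullet> x) *\<^sub>R v \<in> span (insert v B)" by (intro span_scale span_base) simp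
      ultimately have "(x - (v \<bullet> x) *\<^sub>R v) + (v \<bullet> x) *\<^sub>R v \<in> span (insert v B)"
        by (rule span_add)
      then show "x \<in> span (insert v B)" by simp
    qed
    ultimately show ?thesis using B v by (intro exI[of _ "insert v B"]) auto
  qed
qed

text \<open>
  The array acts on the coordinate subspace of vectors supported in \<open>I\<close>, where the spectral theorem
  applies. The second property, the orthonormality of the columns, is the expansion of the
  standard basis vectors in the eigenbasis.
\<close>

lemma symmetric_array_eigenbasis:
  fixes A :: "'n::finite \<Rightarrow> 'n \<Rightarrow> real"
  assumes sym: "\<And>p q. p \<in> I \<Longrightarrow> q \<in> I \<Longrightarrow> A p q = A q p"
  obtains u :: "nat \<Rightarrow> 'n \<Rightarrow> real" and ev :: "nat \<Rightarrow> real" where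
    "\<And>j k. j \<in> {1..card I} \<Longrightarrow> k \<in> {1..card I} \<Longrightarrow> (\<Sum>p\<in>I. u j p * u k p) = (if j = k then 1 else 0)"
    "\<And>p q. p \<in> I \<Longrightarrow> q \<in> I \<Longrightarrow> (\<Sum>j=1..card I. u j p * u j q) = (if p = q then 1 else 0)"
    "\<And>j p. j \<in> {1..card I} \<Longrightarrow> p \<in> I \<Longrightarrow> (\<Sum>q\<in>I. A p q * u j q) = ev j * u j p"
proof -
  define S where "S = {x :: real ^ 'n. \<forall>i. i \<notin> I \<longrightarrow> x $ i = 0}"
  define f where "f x = (\<chi> p. if p \<in> I then \<Sum>q\<in>I. A p q * x $ q else 0)" for x :: "real ^ 'n"
  have inner_S: "x \<bullet> y = (\<Sum>p\<in>I. x $ p * y $ p)" if "x \<in> S" for x y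
    unfolding inner_vec_def using that by (intro sum.mono_neutral_cong_right) (auto simp: S_def)
  have f: "linear f"
    by (rule linearI) (auto simp: f_def vec_eq_iff algebra_simps sum.distrib sum_distrib_left)
  have f_S: "f x \<in> S" for x by (simp add: f_def S_def)
  have "x \<bullet> f y = f x \<bullet> y" for x y
  proof -
    have "x \<bullet> f y = (\<Sum>p\<in>I. \<Sum>q\<in>I. A p q * x $ p * y $ q)"
      unfolding inner_commute[of x] inner_S[OF f_S]
      by (intro sum.cong refl) (simp add: f_def sum_distrib_left sum_distrib_right mult_ac)
    also have "\<dots> = (\<Sum>q\<in>I. \<Sum>p\<in>I. A p q * x $ p * y $ q)" by (rule sum.swap)
    also have "\<dots> = f x \<bullet> y"
      unfolding inner_S[OF f_S]
      by (intro sum.cong refl) (auto simp: f_def sum_distrib_left sum_distrib_right sym intro!: sum.cong)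
    finally show ?thesis .
  qed
  moreover have S: "subspace S" by (auto simp: S_def subspace_def)
  ultimately obtain B where B: "finite B" "pairwise orthogonal B" "\<forall>b\<in>B. norm b = 1"
    "span B = S" "\<forall>b\<in>B. f b = (b \<bullet> f b) *\<^sub>R b"
    using selfadjoint_eigenbasis[OF f] f_S by blast
  have "independent B" using B(2,3) by (intro pairwise_orthogonal_independent) auto
  then have "card B = dim S" using B(4) dim_span_eq_card_independent by metis
  also have "dim S = card I" unfolding S_def dim_vec_eq[symmetric] by (rule dim_substandard_cart)
  finally have "card B = card I" .
  then obtain e where e: "bij_betw e {1..card I} B"
    using ex_bij_betw_nat_finite_1[OF B(1)] by auto
  have eB: "e j \<in> B" if "j \<in> {1..card I}" for j using e that by (auto simp: bij_betw_def)
  have BS: "B \<subseteq> S" using B(4) span_superset by blast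
  show ?thesis
  proof (rule that[of "\<lambda>j p. e j $ p" "\<lambda>j. e j \<bullet> f (e j)"])
    fix j k assume jk: "j \<in> {1..card I}" "k \<in> {1..card I}"
    have "(\<Sum>p\<in>I. e j $ p * e k $ p) = e j \<bullet> e k" using eB[OF jk(1)] BS inner_S by auto
    also have "\<dots> = (if j = k then 1 else 0)"
    proof (cases "j = k")
      case True
      then show ?thesis using B(3) eB[OF jk(1)] by (simp add: dot_square_norm)
    next
      case False
      then have "e j \<noteq> e k" using inj_onD[OF bij_betw_imp_inj_on[OF e]] jk by blast
      then show ?thesis using B(2) eB[OF jk(1)] eB[OF jk(2)] False
        by (simp add: pairwise_def orthogonal_def)
    qed
    finally show "(\<Sum>p\<in>I. e j $ p * e k $ p) = (if j = k then 1 else 0)" .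
  next
    fix p q assume pq: "p \<in> I" "q \<in> I"
    have "axis p 1 \<in> span B" using pq by (auto simp: B(4) S_def axis_def)
    then have "axis p 1 = (\<Sum>b\<in>B. (b \<bullet> axis p 1) *\<^sub>R b)"
      using orthonormal_basis_expand[OF B(2) _ _ B(1), of "axis p 1"] B(3) by (simp add: inner_commute)
    then have "axis p (1::real) $ q = (\<Sum>b\<in>B. (b \<bullet> axis p 1) *\<^sub>R b) $ q" by simp
    also have "\<dots> = (\<Sum>b\<in>B. b $ p * b $ q)" by (simp add: inner_axis)
    also have "\<dots> = (\<Sum>j=1..card I. e j $ p * e j $ q)"
      using sum.reindex_bij_betw[OF e, of "\<lambda>b. b $ p * b $ q"] by simp
    finally show "(\<Sum>j=1..card I. e j $ p * e j $ q) = (if p = q then 1 else 0)"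
      by (auto simp: axis_def split: if_splits)
  next
    fix j p assume j: "j \<in> {1..card I}" and p: "p \<in> I"
    have "f (e j) $ p = ((e j \<bullet> f (e j)) *\<^sub>R e j) $ p" using B(5) eB[OF j] by simp
    then show "(\<Sum>q\<in>I. A p q * e j $ q) = (e j \<bullet> f (e j)) * e j $ p"
      using p by (simp add: f_def)
  qed
qed

text \<open>
  The matrix \<open>P\<close> of the eigenvectors is orthogonal with inverse \<open>Q\<close>, its transpose, and conjugates the
  array into the diagonal matrix \<open>D\<close>. The eigenvectors are numbered from 1 and matrix rows from 0,
  hence the shifts by \<open>Suc\<close>.
\<close>

lemma proots_char_poly_enum_mat:
  fixes A :: "'n \<Rightarrow> 'n \<Rightarrow> real"
  assumes b: "bij_betw b {..<card I} I"
    and on: "\<And>j k. j \<in> {1..card I} \<Longrightarrow> k \<in> {1..card I} \<Longrightarrow> (\<Sum>p\<in>I. u j p * u k p) = (if j = k then 1 else 0)"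
    and complete: "\<And>p q. p \<in> I \<Longrightarrow> q \<in> I \<Longrightarrow> (\<Sum>j=1..card I. u j p * u j q) = (if p = q then 1 else 0)"
    and eigen: "\<And>j p. j \<in> {1..card I} \<Longrightarrow> p \<in> I \<Longrightarrow> (\<Sum>q\<in>I. A p q * u j q) = ev j * u j p"
  shows "proots (char_poly (enum_mat (card I) b A)) = image_mset ev (mset_set {1..card I})"
proof -
  define d where "d = card I"
  have bI: "b i \<in> I" if "i < d" for i using b that by (auto simp: d_def bij_betw_def)
  have b_eq: "b i = b k \<longleftrightarrow> i = k" if "i < d" "k < d" for i k
    using b that by (auto simp: d_def bij_betw_def inj_on_def)
  have fin: "finite I" using b bij_betw_finite by blast
  have sum_b: "(\<Sum>i<d. g (b i)) = (\<Sum>p\<in>I. g p)" for g :: "'n \<Rightarrow> real"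
    unfolding d_def by (rule sum.reindex_bij_betw[OF b])
  have sum_Suc: "(\<Sum>i<d. g (Suc i)) = (\<Sum>j=1..d. g j)" for g :: "nat \<Rightarrow> real"
    by (rule sum.reindex_bij_witness[of _ "\<lambda>j. j - 1" Suc]) auto
  define P where "P = mat d d (\<lambda>(i, k). u (Suc k) (b i))"
  define Q where "Q = mat d d (\<lambda>(i, k). u (Suc i) (b k))"
  define D where "D = mat d d (\<lambda>(i, k). if i = k then ev (Suc i) else 0)"
  have carrier: "P \<in> carrier_mat d d" "Q \<in> carrier_mat d d" "D \<in> carrier_mat d d"
    by (auto simp: P_def Q_def D_def)
  have PQ: "P * Q = 1\<^sub>m d"
    using complete bI b_eq sum_Suc[of "\<lambda>j. u j (b _) * u j (b _)"]
    by (intro eq_matI) (auto simp: P_def Q_def scalar_prod_def d_def[symmetric] lessThan_atLeast0[symmetric])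
  have QP: "Q * P = 1\<^sub>m d"
    using on sum_b[of "\<lambda>p. u _ p * u _ p"]
    by (intro eq_matI) (auto simp: P_def Q_def scalar_prod_def d_def[symmetric] lessThan_atLeast0[symmetric])
  have spec: "(\<Sum>j=1..d. u j p * ev j * u j q) = A p q" if "p \<in> I" "q \<in> I" for p q
  proof -
    have "(\<Sum>j=1..d. u j p * ev j * u j q) = (\<Sum>j=1..d. \<Sum>r\<in>I. A p r * (u j r * u j q))"
      using eigen that by (intro sum.cong refl)
        (simp add: d_def mult.assoc[symmetric] sum_distrib_right[symmetric] mult.commute[of "ev _"])
    also have "\<dots> = (\<Sum>r\<in>I. A p r * (\<Sum>j=1..d. u j r * u j q))"
      by (subst sum.swap) (simp add: sum_distrib_left)
    also have "\<dots> = (\<Sum>r\<in>I. A p r * (if r = q then 1 else 0))"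
      using complete that by (intro sum.cong refl) (simp add: d_def)
    also have "\<dots> = A p q" using that fin by (simp add: if_distrib cong: if_cong)
    finally show ?thesis .
  qed
  have PD: "P * D = mat d d (\<lambda>(i, k). u (Suc k) (b i) * ev (Suc k))"
    by (intro eq_matI) (auto simp: P_def D_def scalar_prod_def if_distrib cong: if_cong)
  have "P * D * Q = enum_mat d b A"
    unfolding PD
  proof (intro eq_matI)
    fix i k assume "i < dim_row (enum_mat d b A)" "k < dim_col (enum_mat d b A)"
    then have ik: "i < d" "k < d" by (auto simp: enum_mat_def)
    have "(mat d d (\<lambda>(i, k). u (Suc k) (b i) * ev (Suc k)) * Q) $$ (i, k) =
        (\<Sum>j<d. u (Suc j) (b i) * ev (Suc j) * u (Suc j) (b k))"
      using ik by (simp add: Q_def scalar_prod_def lessThan_atLeast0)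
    also have "\<dots> = A (b i) (b k)"
      using sum_Suc[of "\<lambda>j. u j (b i) * ev j * u j (b k)"] spec[OF bI bI] ik by simp
    finally show "(mat d d (\<lambda>(i, k). u (Suc k) (b i) * ev (Suc k)) * Q) $$ (i, k) = enum_mat d b A $$ (i, k)"
      using ik by (simp add: enum_mat_def)
  qed (auto simp: enum_mat_def Q_def)
  moreover have "enum_mat d b A \<in> carrier_mat d d" by (simp add: enum_mat_def)
  ultimately have "similar_mat (enum_mat d b A) D"
    using carrier PQ QP by (intro similar_matI[of _ D P Q d]) simp_all
  then have "char_poly (enum_mat d b A) = char_poly D" by (rule char_poly_similar)
  also have "\<dots> = (\<Prod>a\<leftarrow>diag_mat D. [:- a, 1:])"
    by (rule char_poly_upper_triangular[OF carrier(3)]) (auto simp: D_def)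
  also have "diag_mat D = map (\<lambda>i. ev (Suc i)) [0..<d]"
    by (auto simp: diag_mat_def D_def)
  finally have "char_poly (enum_mat d b A) = (\<Prod>i\<leftarrow>[0..<d]. [:- ev (Suc i), 1:])"
    by (simp add: o_def)
  moreover have "proots (\<Prod>i\<leftarrow>xs. [:- ev (Suc i), 1:]) = image_mset (\<lambda>i. ev (Suc i)) (mset xs)" for xs
  proof (induction xs)
    case (Cons i xs)
    have "(\<Prod>i\<leftarrow>xs. [:- ev (Suc i), 1:]) \<noteq> 0" by (auto simp: prod_list_zero_iff)
    then have "proots ([:- ev (Suc i), 1:] * (\<Prod>i\<leftarrow>xs. [:- ev (Suc i), 1:])) =
        proots [:- ev (Suc i), 1:] + proots (\<Prod>i\<leftarrow>xs. [:- ev (Suc i), 1:])"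
      by (intro proots_mult) simp_all
    then show ?case using Cons by (simp del: mult_pCons_left)
  qed simp
  ultimately have "proots (char_poly (enum_mat d b A)) = image_mset ev (image_mset Suc (mset_set {0..<d}))"
    by (simp add: multiset.map_comp o_def)
  also have "image_mset Suc (mset_set {0..<d}) = mset_set {1..d}"
    by (subst image_mset_mset_set) (auto simp: image_Suc_atLeastLessThan atLeastLessThanSuc_atLeastAtMost)
  finally show ?thesis by (simp add: d_def)
qed

text \<open>
  The sum of the eigenvalues is the trace of the matrix in the eigenbasis, and the
  completeness relation carries it back to the standard basis.
\<close>

lemma sum_eigenvalues_eq_trace:
  fixes A :: "'n \<Rightarrow> 'n \<Rightarrow> real"
  assumes fin: "finite I"
    and norm: "\<And>j. j \<in> J \<Longrightarrow> (\<Sum>p\<in>I. u j p * u j p) = 1"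
    and complete: "\<And>p q. p \<in> I \<Longrightarrow> q \<in> I \<Longrightarrow> (\<Sum>j\<in>J. u j p * u j q) = (if p = q then 1 else 0)"
    and eigen: "\<And>j p. j \<in> J \<Longrightarrow> p \<in> I \<Longrightarrow> (\<Sum>q\<in>I. A p q * u j q) = ev j * u j p"
  shows "(\<Sum>j\<in>J. ev j) = (\<Sum>p\<in>I. A p p)"
proof -
  have "(\<Sum>j\<in>J. ev j) = (\<Sum>j\<in>J. \<Sum>p\<in>I. \<Sum>q\<in>I. A p q * (u j p * u j q))"
  proof (intro sum.cong refl)
    fix j assume j: "j \<in> J"
    have "ev j = (\<Sum>p\<in>I. (ev j * u j p) * u j p)"
      using norm[OF j] by (simp add: mult.assoc sum_distrib_left[symmetric])
    also have "\<dots> = (\<Sum>p\<in>I. (\<Sum>q\<in>I. A p q * u j q) * u j p)"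
      using eigen[OF j] by (intro sum.cong) simp_all
    finally show "ev j = (\<Sum>p\<in>I. \<Sum>q\<in>I. A p q * (u j p * u j q))"
      by (simp add: sum_distrib_left sum_distrib_right mult_ac)
  qed
  also have "\<dots> = (\<Sum>p\<in>I. \<Sum>q\<in>I. \<Sum>j\<in>J. A p q * (u j p * u j q))"
    by (subst sum.swap) (intro sum.cong refl sum.swap)
  also have "\<dots> = (\<Sum>p\<in>I. \<Sum>q\<in>I. A p q * (if p = q then 1 else 0))"
    using complete by (intro sum.cong refl) (simp add: sum_distrib_left[symmetric])
  also have "\<dots> = (\<Sum>p\<in>I. A p p)"
    using fin by (intro sum.cong refl) (simp add: if_distrib cong: if_cong)
  finally show ?thesis .
qed

section \<open>Square integrable functions and forms\<close>

lemma L2_D: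
  assumes "f \<in> L2 M"
  shows L2_measurable: "f \<in> borel_measurable M" and L2_integrable: "integrable M (\<lambda>z. (cmod (f z))\<^sup>2)"
  using assms by (simp_all add: L2_def)

lemma L2_mult_integrable:
  assumes "f \<in> L2 M" "g \<in> L2 M"
  shows "integrable M (\<lambda>z. f z * cnj (g z))"
proof (rule Bochner_Integration.integrable_bound)
  show "integrable M (\<lambda>z. (cmod (f z))\<^sup>2 + (cmod (g z))\<^sup>2)"
    by (intro Bochner_Integration.integrable_add L2_integrable assms)
  show "(\<lambda>z. f z * cnj (g z)) \<in> borel_measurable M"
    by (intro borel_measurable_times L2_measurable assms
        borel_measurable_continuous_on[OF continuous_on_cnj[OF continuous_on_id]])
  have "cmod (f z * cnj (g z)) \<le> (cmod (f z))\<^sup>2 + (cmod (g z))\<^sup>2" for z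
  proof -
    have "0 \<le> cmod (f z) * cmod (g z)" by simp
    then show ?thesis
      using sum_squares_bound[of "cmod (f z)" "cmod (g z)"] unfolding norm_mult complex_mod_cnj by linarith
  qed
  then show "AE z in M. norm (f z * cnj (g z)) \<le> norm ((cmod (f z))\<^sup>2 + (cmod (g z))\<^sup>2)"
    by (simp add: order_trans[OF _ abs_ge_self])
qed

lemma subspace_L2: "fn.subspace (L2 M)"
proof (rule fn.subspaceI)
  fix f g assume fg: "f \<in> L2 M" "g \<in> L2 M"
  have "integrable M (\<lambda>z. (cmod ((f + g) z))\<^sup>2)"
  proof (rule Bochner_Integration.integrable_bound)
    show "integrable M (\<lambda>z. 2 * (cmod (f z))\<^sup>2 + 2 * (cmod (g z))\<^sup>2)"
      by (intro Bochner_Integration.integrable_add integrable_mult_right L2_integrable fg)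
    show "(\<lambda>z. (cmod ((f + g) z))\<^sup>2) \<in> borel_measurable M"
      using L2_measurable[OF fg(1)] L2_measurable[OF fg(2)] unfolding plus_fun_def by measurable
    have "(cmod (f z + g z))\<^sup>2 \<le> 2 * (cmod (f z))\<^sup>2 + 2 * (cmod (g z))\<^sup>2" for z
    proof -
      have "(cmod (f z + g z))\<^sup>2 \<le> (cmod (f z) + cmod (g z))\<^sup>2"
        by (intro power_mono norm_triangle_ineq) simp
      also have "\<dots> \<le> 2 * (cmod (f z))\<^sup>2 + 2 * (cmod (g z))\<^sup>2"
        using sum_squares_bound[of "cmod (f z)" "cmod (g z)"] by (simp add: power2_sum)
      finally show ?thesis .
    qed
    then show "AE z in M. norm ((cmod ((f + g) z))\<^sup>2) \<le> norm (2 * (cmod (f z))\<^sup>2 + 2 * (cmod (g z))\<^sup>2)"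
      by (simp add: order_trans[OF _ abs_ge_self])
  qed
  then show "f + g \<in> L2 M" using fg by (auto simp: L2_def plus_fun_def)
next
  fix c f assume "f \<in> L2 M"
  then show "fun_scale c f \<in> L2 M"
    by (auto simp: L2_def fun_scale_def norm_mult power_mult_distrib)
qed (simp add: L2_def zero_fun_def)

lemma l2_inner_self: "l2_inner M f f = of_real ((l2_norm M f)\<^sup>2)"
proof -
  have "l2_inner M f f = (LINT z|M. complex_of_real ((cmod (f z))\<^sup>2))"
    unfolding l2_inner_def by (intro Bochner_Integration.integral_cong refl) (rule complex_norm_square[symmetric])
  also have "\<dots> = of_real (LINT z|M. (cmod (f z))\<^sup>2)" by (rule integral_complex_of_real)
  also have "(LINT z|M. (cmod (f z))\<^sup>2) = (l2_norm M f)\<^sup>2"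
    unfolding l2_norm_def by (simp add: integral_nonneg_AE)
  finally show ?thesis .
qed

lemma semi_inner_space_L2: "semi_inner_space fun_scale (L2 M) (l2_inner M)"
proof unfold_locales
  show "fn.subspace (L2 M)" by (rule subspace_L2)
next
  fix f g h assume "f \<in> L2 M" "g \<in> L2 M" "h \<in> L2 M"
  then show "l2_inner M (f + g) h = l2_inner M f h + l2_inner M g h"
    unfolding l2_inner_def
    by (subst Bochner_Integration.integral_add[symmetric])
      (auto intro!: L2_mult_integrable simp: algebra_simps)
next
  fix f g c assume "f \<in> L2 M" "g \<in> L2 M"
  then show "l2_inner M (fun_scale c f) g = c * l2_inner M f g"
    unfolding l2_inner_def fun_scale_def by (simp add: mult.assoc)
next
  fix f g assume "f \<in> L2 M" "g \<in> L2 M"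
  show "l2_inner M g f = cnj (l2_inner M f g)"
    unfolding l2_inner_def by (subst Bochner_Integration.integral_cnj[symmetric]) (simp add: mult.commute)
next
  fix f
  show "0 \<le> Re (l2_inner M f f)" by (simp add: l2_inner_self del: of_real_power)
qed

lemma nrm_l2: "semi_inner_space.nrm (l2_inner M) f = l2_norm M f"
proof -
  have "0 \<le> l2_norm M f" by (simp add: l2_norm_def integral_nonneg_AE)
  then show ?thesis
    by (simp add: semi_inner_space.nrm_def[OF semi_inner_space_L2] l2_inner_self del: of_real_power)
qed

global_interpretation l2: semi_inner_space fun_scale "L2 M" "l2_inner M"
  rewrites "semi_inner_space.nrm (l2_inner M) = l2_norm M" for M :: "'a measure"
  by (rule semi_inner_space_L2) (simp add: nrm_l2 fun_eq_iff)

lemma sum_fun_apply: "(\<Sum>i\<in>I. f i) z = (\<Sum>i\<in>I. f i z)"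
  for f :: "'i \<Rightarrow> 'a \<Rightarrow> 'b::comm_monoid_add"
  by (induction I rule: infinite_finite_induct) auto

lemma coeff_fun_simps [simp]:
  "coeff_fun 0 j = 0"
  "coeff_fun (\<omega> + \<eta>) j = coeff_fun \<omega> j + coeff_fun \<eta> j"
  "coeff_fun (\<omega> - \<eta>) j = coeff_fun \<omega> j - coeff_fun \<eta> j"
  "coeff_fun (form_scale c \<omega>) j = fun_scale c (coeff_fun \<omega> j)"
  by (auto simp: coeff_fun_def form_scale_def fun_scale_def fun_eq_iff)

lemma coeff_fun_monomial_form:
  "coeff_fun (monomial_form \<alpha> j) k = (if k = j then monomial \<alpha> else 0)"
  by (auto simp: coeff_fun_def monomial_form_def axis_def fun_eq_iff)

lemma form_inner_self: "form_inner M \<omega> \<omega> = of_real ((form_norm M \<omega>)\<^sup>2)"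
  by (simp add: form_inner_def form_norm_def l2_inner_self sum_nonneg)

lemma semi_inner_space_L2_form: "semi_inner_space form_scale (L2_form M) (form_inner M)"
proof unfold_locales
  show "form.subspace (L2_form M)"
    by (rule form.subspaceI) (auto simp: L2_form_def)
next
  fix \<omega> \<eta> \<theta> assume "\<omega> \<in> L2_form M" "\<eta> \<in> L2_form M" "\<theta> \<in> L2_form M"
  then show "form_inner M (\<omega> + \<eta>) \<theta> = form_inner M \<omega> \<theta> + form_inner M \<eta> \<theta>"
    by (simp add: form_inner_def L2_form_def l2.ip_add_left sum.distrib)
next
  fix \<omega> \<eta> c assume "\<omega> \<in> L2_form M" "\<eta> \<in> L2_form M"
  then show "form_inner M (form_scale c \<omega>) \<eta> = c * form_inner M \<omega> \<eta>"
    by (simp add: form_inner_def L2_form_def l2.ip_scale_left sum_distrib_left)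
next
  fix \<omega> \<eta> assume H: "\<omega> \<in> L2_form M" "\<eta> \<in> L2_form M"
  then show "form_inner M \<eta> \<omega> = cnj (form_inner M \<omega> \<eta>)"
    unfolding form_inner_def cnj_sum by (intro sum.cong refl l2.ip_commute) (auto simp: L2_form_def)
next
  fix \<omega>
  show "0 \<le> Re (form_inner M \<omega> \<omega>)" by (simp add: form_inner_self del: of_real_power)
qed

lemma nrm_form: "semi_inner_space.nrm (form_inner M) \<omega> = form_norm M \<omega>"
proof -
  have "0 \<le> form_norm M \<omega>" by (simp add: form_norm_def sum_nonneg)
  then show ?thesis
    by (simp add: semi_inner_space.nrm_def[OF semi_inner_space_L2_form] form_inner_self del: of_real_power)
qed

global_interpretation l2f: semi_inner_space form_scale "L2_form M" "form_inner M"
  rewrites "semi_inner_space.nrm (form_inner M) = form_norm M" for M :: "(complex ^ 'n::finite) measure"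
  by (rule semi_inner_space_L2_form) (simp add: nrm_form fun_eq_iff)

lemma hilbert_sum_eq_orth_sum: "hilbert_sum M I V = l2f.orth_sum M I V"
  by (simp add: hilbert_sum_def l2f.orth_sum_def)

lemma A2_eq_closure_in: "A2 M = l2.closure_in M (fn.span {monomial \<alpha> | \<alpha>. 0 \<le> \<alpha>})"
  by (simp add: A2_def l2.closure_in_def)

section \<open>Multiindices and monomials\<close>

lemma idx_nonneg_iff: "0 \<le> (\<alpha> :: int ^ 'n::finite) \<longleftrightarrow> (\<forall>i. 0 \<le> \<alpha> $ i)"
  by (simp add: Finite_Cartesian_Product.less_eq_vec_def)

lemma unit_idx_nth: "unit_idx p $ i = (if i = p then 1 else 0)"
  by (simp add: unit_idx_def axis_def)

lemma unit_idx_nonneg [simp]: "0 \<le> unit_idx p"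
  by (simp add: idx_nonneg_iff unit_idx_nth)

lemma add_unit_idx_nonneg: "0 \<le> \<alpha> \<Longrightarrow> 0 \<le> \<alpha> + unit_idx p"
  by (auto simp: idx_nonneg_iff unit_idx_nth)

lemma monomial_add:
  assumes "0 \<le> \<alpha>" "0 \<le> \<beta>"
  shows "monomial (\<alpha> + \<beta>) z = monomial \<alpha> z * monomial \<beta> z"
  unfolding monomial_def prod.distrib[symmetric]
proof (intro prod.cong refl)
  fix j
  have "0 \<le> \<alpha> $ j" "0 \<le> \<beta> $ j" using assms by (auto simp: idx_nonneg_iff)
  then show "(z $ j) powi ((\<alpha> + \<beta>) $ j) = (z $ j) powi (\<alpha> $ j) * (z $ j) powi (\<beta> $ j)"
    by (cases "\<alpha> $ j + \<beta> $ j = 0") (auto simp: power_int_add add_nonneg_eq_0_iff)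
qed

lemma monomial_unit_idx: "monomial (unit_idx p) z = z $ p"
proof -
  have "monomial (unit_idx p) z = (\<Prod>j\<in>UNIV. if j = p then z $ p else 1)"
    unfolding monomial_def by (intro prod.cong) (auto simp: unit_idx_nth)
  then show ?thesis by simp
qed

lemma monomial_add_unit_idx: "0 \<le> \<alpha> \<Longrightarrow> monomial (\<alpha> + unit_idx p) z = z $ p * monomial \<alpha> z"
  by (simp add: monomial_add monomial_unit_idx mult.commute)

lemma continuous_on_monomial: "0 \<le> \<alpha> \<Longrightarrow> continuous_on A (monomial \<alpha>)"
  unfolding monomial_def[abs_def] idx_nonneg_iff
  by (intro continuous_on_prod) (auto simp: power_int_def intro!: continuous_intros)

locale orthogonal_monomials =
  fixes M :: "(complex ^ 'n::finite) measure"
  assumes sets_M: "sets M = sets borel"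
    and norm_pos: "0 \<le> \<alpha> \<Longrightarrow> 0 < (\<integral>\<^sup>+z. ennreal ((cmod (monomial \<alpha> z))\<^sup>2) \<partial>M)"
    and norm_finite: "0 \<le> \<alpha> \<Longrightarrow> (\<integral>\<^sup>+z. ennreal ((cmod (monomial \<alpha> z))\<^sup>2) \<partial>M) < \<infinity>"
    and orthogonal: "0 \<le> \<alpha> \<Longrightarrow> 0 \<le> \<beta> \<Longrightarrow> \<alpha> \<noteq> \<beta> \<Longrightarrow> l2_inner M (monomial \<alpha>) (monomial \<beta>) = 0"
begin

lemma borel_measurable_M: "continuous_on UNIV f \<Longrightarrow> f \<in> borel_measurable M"
  using borel_measurable_continuous_onI[of f] measurable_cong_sets[OF sets_M refl] by blast

lemma monomial_in_L2: 
  assumes "0 \<le> \<alpha>"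
  shows "monomial \<alpha> \<in> L2 M"
proof -
  have "monomial \<alpha> \<in> borel_measurable M"
    using continuous_on_monomial[OF assms] by (rule borel_measurable_M)
  moreover from this have "integrable M (\<lambda>z. (cmod (monomial \<alpha> z))\<^sup>2)"
    using norm_finite[OF assms] by (intro integrableI_nonneg) auto
  ultimately show ?thesis by (simp add: L2_def)
qed

lemma cc_pos:
  assumes "0 \<le> \<alpha>"
  shows "0 < cc M \<alpha>"
proof -
  have "(\<integral>\<^sup>+z. ennreal ((cmod (monomial \<alpha> z))\<^sup>2) \<partial>M) = ennreal (LINT z|M. (cmod (monomial \<alpha> z))\<^sup>2)"
    by (intro nn_integral_eq_integral L2_integrable monomial_in_L2 assms) simp
  then have "0 < (LINT z|M. (cmod (monomial \<alpha> z))\<^sup>2)"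
    using norm_pos[OF assms] by simp
  then show ?thesis using assms by (simp add: cc_def)
qed

lemma l2_inner_monomial:
  assumes "0 \<le> \<alpha>" "0 \<le> \<beta>"
  shows "l2_inner M (monomial \<alpha>) (monomial \<beta>) = (if \<alpha> = \<beta> then of_real (1 / cc M \<alpha>) else 0)"
  using assms orthogonal
  by (auto simp: l2_inner_self cc_def l2_norm_def integral_nonneg_AE inverse_eq_divide simp flip: of_real_power)

lemma monomial_form_in_L2_form: "0 \<le> \<alpha> \<Longrightarrow> monomial_form \<alpha> j \<in> L2_form M"
  by (auto simp: L2_form_def coeff_fun_monomial_form monomial_in_L2)

lemma poly_forms_subset_L2_form: "poly_forms \<subseteq> L2_form M"
  unfolding poly_forms_def by (rule l2f.span_subset_H) (auto simp: monomial_form_in_L2_form)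

lemma form_inner_monomial_form:
  assumes "0 \<le> \<alpha>" "0 \<le> \<beta>"
  shows "form_inner M (monomial_form \<alpha> j) (monomial_form \<beta> k) =
    (if \<alpha> = \<beta> \<and> j = k then of_real (1 / cc M \<alpha>) else 0)"
proof -
  have "form_inner M (monomial_form \<alpha> j) (monomial_form \<beta> k) =
      (\<Sum>i\<in>UNIV. if i = j then (if j = k then l2_inner M (monomial \<alpha>) (monomial \<beta>) else 0) else 0)"
    unfolding form_inner_def using assms
    by (intro sum.cong refl) (auto simp: coeff_fun_monomial_form monomial_in_L2)
  then show ?thesis using assms by (simp add: l2_inner_monomial)
qed

lemma inj_monomial_form:
  fixes \<alpha> \<beta> :: "int ^ 'n"
  assumes "0 \<le> \<alpha>" "0 \<le> \<beta>" "monomial_form \<alpha> j = monomial_form \<beta> k"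
  shows "\<alpha> = \<beta> \<and> j = k"
proof -
  have "form_inner M (monomial_form \<alpha> j) (monomial_form \<beta> k) \<noteq> 0"
    using form_inner_monomial_form[OF assms(1,1), of j j] cc_pos[OF assms(1)] assms(3) by simp
  then show ?thesis using form_inner_monomial_form[OF assms(1,2), of j k] by (auto split: if_splits)
qed

lemma independent_monomial_forms: "form.independent {monomial_form \<alpha> j | \<alpha> (j :: 'n). 0 \<le> \<alpha>}"
proof (rule l2f.independent_orthogonal[where M = M])
  show "{monomial_form \<alpha> j | \<alpha> j. 0 \<le> \<alpha>} \<subseteq> L2_form M"
    by (auto simp: monomial_form_in_L2_form)
next
  fix \<omega> \<eta> :: "'n form"
  assume "\<omega> \<in> {monomial_form \<alpha> j | \<alpha> j. 0 \<le> \<alpha>}" "\<eta> \<in> {monomial_form \<alpha> j | \<alpha> j. 0 \<le> \<alpha>}" "\<omega> \<noteq> \<eta>"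
  then show "form_inner M \<omega> \<eta> = 0" by (auto simp: form_inner_monomial_form)
next
  fix \<omega> :: "'n form" assume "\<omega> \<in> {monomial_form \<alpha> j | \<alpha> j. 0 \<le> \<alpha>}"
  then obtain \<alpha> j where "\<omega> = monomial_form \<alpha> j" "0 \<le> \<alpha>" by auto
  then show "form_inner M \<omega> \<omega> \<noteq> 0"
    using cc_pos[of \<alpha>] by (simp add: form_inner_monomial_form)
qed

text \<open>
  The space of forms is defined by a density condition on each coefficient separately. Approximating
  all coefficients at the same time is the same as approximating the form, because the squared norm of
  a form is the finite sum of the squared norms of its coefficients.
\<close>

lemma A2_form_eq_closure_in: "A2_form M = l2f.closure_in M poly_forms"
proof (intro equalityI subsetI)
  fix \<omega> assume \<omega>: "\<omega> \<in> A2_form M"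
  then have L2: "\<omega> \<in> L2_form M" by (simp add: A2_form_def L2_form_def A2_def)
  have "\<exists>p\<in>poly_forms. form_norm M (\<omega> - p) < \<epsilon>" if \<epsilon>: "\<epsilon> > 0" for \<epsilon>
  proof -
    \<comment> \<open>An error below \<open>\<delta>\<close> in each of the coefficients adds up to less than \<open>\<epsilon>\<close>.\<close>
    define \<delta> where "\<delta> = \<epsilon> / sqrt (CARD('n))"
    have \<delta>: "\<delta> > 0" using \<epsilon> by (simp add: \<delta>_def)
    have "\<exists>p. p \<in> fn.span {monomial \<alpha> | \<alpha>. 0 \<le> \<alpha>} \<and> l2_norm M (coeff_fun \<omega> j - p) < \<delta>" for j
      using \<omega> \<delta> unfolding A2_form_def A2_def by blast
    then have "\<forall>j. \<exists>p. p \<in> fn.span {monomial \<alpha> | \<alpha>. 0 \<le> \<alpha>} \<and> l2_norm M (coeff_fun \<omega> j - p) < \<delta>"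
      by blast
    from choice[OF this] obtain p where p: "\<And>j. p j \<in> fn.span {monomial \<alpha> | \<alpha>. 0 \<le> \<alpha>}"
      "\<And>j. l2_norm M (coeff_fun \<omega> j - p j) < \<delta>" by blast
    define P where "P = (\<Sum>j\<in>UNIV. (\<lambda>z. axis j (p j z)) :: 'n form)"
    have "(\<lambda>z. axis j (q z)) \<in> poly_forms" if "q \<in> fn.span {monomial \<alpha> | \<alpha>. 0 \<le> \<alpha>}" for q and j :: 'n
      using that
    proof (induction rule: fn.span_induct_alt)
      case base
      have "(\<lambda>z. axis j ((0 :: complex ^ 'n \<Rightarrow> complex) z)) = (0 :: 'n form)"
        by (auto simp: fun_eq_iff vec_eq_iff axis_def)
      then show ?case by (simp add: poly_forms_def form.span_zero del: zero_fun_apply)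
    next
      case (step c x y)
      then obtain \<alpha> where \<alpha>: "x = monomial \<alpha>" "0 \<le> \<alpha>" by auto
      have "(\<lambda>z. axis j ((fun_scale c x + y) z)) = form_scale c (monomial_form \<alpha> j) + (\<lambda>z. axis j (y z))"
        by (auto simp: \<alpha> fun_eq_iff vec_eq_iff axis_def monomial_form_def form_scale_def fun_scale_def)
      moreover have "form_scale c (monomial_form \<alpha> j) \<in> poly_forms"
        unfolding poly_forms_def using \<alpha> by (intro form.span_scale form.span_base) auto
      ultimately show ?case using step.IH unfolding poly_forms_def by (simp only: form.span_add)
    qed
    then have P: "P \<in> poly_forms"
      unfolding P_def poly_forms_def using p(1) by (intro form.span_sum) blast
    have coeff: "coeff_fun P j = p j" for j
      by (simp add: coeff_fun_def P_def fun_eq_iff axis_def sum_fun_apply)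
    have "(form_norm M (\<omega> - P))\<^sup>2 = (\<Sum>j\<in>UNIV. (l2_norm M (coeff_fun \<omega> j - p j))\<^sup>2)"
      by (simp add: form_norm_def sum_nonneg coeff)
    also have "\<dots> < (\<Sum>j\<in>(UNIV :: 'n set). \<delta>\<^sup>2)"
      using p(2) by (intro sum_strict_mono power_strict_mono) (auto simp: l2_norm_def integral_nonneg_AE)
    also have "\<dots> = \<epsilon>\<^sup>2" by (simp add: \<delta>_def power_divide)
    finally have "form_norm M (\<omega> - P) < \<epsilon>" using \<epsilon> by (intro power_less_imp_less_base[of _ 2 \<epsilon>]) auto
    then show ?thesis using P by blast
  qed
  then show "\<omega> \<in> l2f.closure_in M poly_forms"
    using L2 by (simp add: l2f.closure_in_def)
next
  fix \<omega> assume \<omega>: "\<omega> \<in> l2f.closure_in M poly_forms"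
  then have L2: "\<omega> \<in> L2_form M" by (simp add: l2f.closure_in_def)
  have coeff_poly: "coeff_fun p j \<in> fn.span {monomial \<alpha> | \<alpha>. 0 \<le> \<alpha>}" if "p \<in> poly_forms" for p j
    using that unfolding poly_forms_def
  proof (induction rule: form.span_induct_alt)
    case (step c x y)
    then obtain \<alpha> k where x: "x = monomial_form \<alpha> k" "0 \<le> \<alpha>" by auto
    then have "coeff_fun x j \<in> fn.span {monomial \<alpha> | \<alpha>. 0 \<le> \<alpha>}"
      unfolding x coeff_fun_monomial_form
      by (cases "j = k") (auto simp: fn.span_zero intro: fn.span_base)
    then show ?case unfolding coeff_fun_simps by (intro fn.span_add fn.span_scale step.IH)
  next
    case base
    show ?case unfolding coeff_fun_simps by (rule fn.span_zero)
  qed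
  have coeff_le: "l2_norm M (coeff_fun \<eta> j) \<le> form_norm M \<eta>" for \<eta> :: "'n form" and j
    unfolding form_norm_def
    by (intro real_le_rsqrt member_le_sum) auto
  have "\<exists>p\<in>fn.span {monomial \<alpha> | \<alpha>. 0 \<le> \<alpha>}. l2_norm M (coeff_fun \<omega> j - p) < \<epsilon>" if \<epsilon>: "\<epsilon> > 0" for \<epsilon> j
  proof -
    obtain p where p: "p \<in> poly_forms" "form_norm M (\<omega> - p) < \<epsilon>"
      using l2f.closure_inD[OF \<omega> \<epsilon>] by auto
    then show ?thesis using coeff_poly[OF p(1), of j] coeff_le[of "\<omega> - p" j]
      by (intro bexI[of _ "coeff_fun p j"]) auto
  qed
  then show "\<omega> \<in> A2_form M" using L2 by (auto simp: A2_form_def A2_def L2_form_def)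
qed

end

section \<open>The orthogonal decomposition of the space of forms\<close>

lemma sub_unit_idx_in_Gamma_set:
  assumes "0 \<le> \<alpha>"
  shows "\<alpha> - unit_idx j \<in> Gamma_set"
proof -
  have "{i. (\<alpha> - unit_idx j) $ i = -1} \<subseteq> {j}"
  proof
    fix i assume "i \<in> {i. (\<alpha> - unit_idx j) $ i = -1}"
    then show "i \<in> {j}"
      using assms spec[OF iffD1[OF idx_nonneg_iff assms], of i] by (auto simp: unit_idx_nth split: if_splits)
  qed
  then have "card {i. (\<alpha> - unit_idx j) $ i = -1} \<le> card {j}" by (intro card_mono) auto
  moreover have "- 1 \<le> (\<alpha> - unit_idx j) $ i" for i
    using spec[OF iffD1[OF idx_nonneg_iff assms], of i] by (auto simp: unit_idx_nth)
  ultimately show ?thesis by (simp add: Gamma_set_def)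
qed

lemma in_idx_sub_unit_idx: "0 \<le> \<alpha> \<Longrightarrow> j \<in> idx (\<alpha> - unit_idx j)"
  by (simp add: idx_def)

text \<open>
  If no entry of \<open>\<gamma>\<close> is \<open>-1\<close>, every index is admissible; otherwise only the position of the unique
  entry \<open>-1\<close> is.
\<close>

lemma card_idx:
  fixes \<gamma> :: "int ^ 'n::finite"
  assumes "\<gamma> \<in> Gamma_set"
  shows "card (idx \<gamma>) \<in> {1, CARD('n)}"
proof -
  have ge: "- 1 \<le> \<gamma> $ i" for i using assms by (simp add: Gamma_set_def)
  show ?thesis
  proof (cases "{j. \<gamma> $ j = -1} = {}")
    case True
    have "0 \<le> \<gamma> $ i" for i
    proof -
      have "\<gamma> $ i \<noteq> -1" using True by auto
      then show ?thesis using ge[of i] by linarith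
    qed
    then have "idx \<gamma> = UNIV" by (auto simp: idx_def idx_nonneg_iff unit_idx_nth)
    then show ?thesis by simp
  next
    case False
    then obtain p where p: "\<gamma> $ p = -1" by auto
    have "card {j. \<gamma> $ j = -1} \<le> 1" using assms by (simp add: Gamma_set_def)
    then have uniq: "i = p" if "\<gamma> $ i = -1" for i
      using that p card_le_Suc0_iff_eq[of "{j. \<gamma> $ j = -1}"] by auto
    have "0 \<le> \<gamma> $ i" if "i \<noteq> p" for i
      using ge[of i] uniq[of i] that by linarith
    then have "p \<in> idx \<gamma>" using p by (auto simp: idx_def idx_nonneg_iff unit_idx_nth)
    moreover have "q = p" if "q \<in> idx \<gamma>" for q
    proof (rule ccontr)
      assume "q \<noteq> p"
      moreover have "0 \<le> (\<gamma> + unit_idx q) $ p"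
        using that unfolding idx_def idx_nonneg_iff by blast
      ultimately show False using p by (simp add: unit_idx_nth)
    qed
    ultimately have "idx \<gamma> = {p}" by blast
    then show ?thesis by simp
  qed
qed

lemma E_space_subset_poly_forms: "E_space \<gamma> \<subseteq> poly_forms"
  unfolding E_space_def poly_forms_def by (rule form.span_mono) (unfold idx_def, blast)

lemma E_space_coords:
  assumes "\<omega> \<in> E_space \<gamma>"
  shows "\<exists>a. \<omega> = (\<Sum>p\<in>idx \<gamma>. form_scale (a p) (monomial_form (\<gamma> + unit_idx p) p))"
  using assms unfolding E_space_def
proof (induction rule: form.span_induct_alt)
  case base
  show ?case by (intro exI[of _ "\<lambda>_. 0"]) simp
next
  case (step c x y)
  then obtain q a where q: "x = monomial_form (\<gamma> + unit_idx q) q" "q \<in> idx \<gamma>"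
    and a: "y = (\<Sum>p\<in>idx \<gamma>. form_scale (a p) (monomial_form (\<gamma> + unit_idx p) p))" by auto
  have "form_scale c x = (\<Sum>p\<in>idx \<gamma>. if p = q then form_scale c (monomial_form (\<gamma> + unit_idx p) p) else 0)"
    using q by simp
  also have "\<dots> = (\<Sum>p\<in>idx \<gamma>. form_scale (if p = q then c else 0) (monomial_form (\<gamma> + unit_idx p) p))"
    by (intro sum.cong) auto
  finally have "form_scale c x + y =
      (\<Sum>p\<in>idx \<gamma>. form_scale ((if p = q then c else 0) + a p) (monomial_form (\<gamma> + unit_idx p) p))"
    unfolding a form.scale_left_distrib sum.distrib by simp
  then show ?case by (rule exI[of _ "\<lambda>p. (if p = q then c else 0) + a p"])
qed

lemma monomial_form_in_E_space:
  assumes "0 \<le> \<alpha>"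
  shows "monomial_form \<alpha> j \<in> E_space (\<alpha> - unit_idx j)"
  unfolding E_space_def using in_idx_sub_unit_idx[OF assms, of j]
  by (intro form.span_base) force

context orthogonal_monomials
begin

text \<open>
  The monomial forms of \<open>E\<^sub>\<gamma>\<close> normalized to length one, since \<open>c \<alpha>\<close> is the inverse of the squared
  norm of the monomial with exponent \<open>\<alpha>\<close>.
\<close>

definition basis_form :: "int ^ 'n \<Rightarrow> 'n \<Rightarrow> 'n form" where
  "basis_form \<gamma> p =
     form_scale (of_real (sqrt (cc M (\<gamma> + unit_idx p)))) (monomial_form (\<gamma> + unit_idx p) p)"

lemma basis_form_in_L2_form: "p \<in> idx \<gamma> \<Longrightarrow> basis_form \<gamma> p \<in> L2_form M"
  unfolding basis_form_def by (intro l2f.H_closed monomial_form_in_L2_form) (simp add: idx_def)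

lemma form_inner_basis_form:
  assumes "p \<in> idx \<gamma>" "q \<in> idx \<gamma>'"
  shows "form_inner M (basis_form \<gamma> p) (basis_form \<gamma>' q) = (if \<gamma> = \<gamma>' \<and> p = q then 1 else 0)"
proof -
  have pos: "0 \<le> \<gamma> + unit_idx p" "0 \<le> \<gamma>' + unit_idx q" using assms by (auto simp: idx_def)
  have "form_inner M (basis_form \<gamma> p) (basis_form \<gamma>' q) =
      of_real (sqrt (cc M (\<gamma> + unit_idx p))) * of_real (sqrt (cc M (\<gamma>' + unit_idx q))) *
      form_inner M (monomial_form (\<gamma> + unit_idx p) p) (monomial_form (\<gamma>' + unit_idx q) q)"
    unfolding basis_form_def using pos
    by (simp add: l2f.ip_scale_left l2f.ip_scale_right monomial_form_in_L2_form l2f.H_closed)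
  also have "\<dots> = (if \<gamma> = \<gamma>' \<and> p = q then 1 else 0)"
    using cc_pos[OF pos(1)] pos
    by (auto simp: form_inner_monomial_form simp flip: of_real_mult)
  finally show ?thesis .
qed

lemma E_space_eq_span_basis_form: "E_space \<gamma> = form.span (basis_form \<gamma> ` idx \<gamma>)"
  for \<gamma> :: "int ^ 'n"
  unfolding E_space_def form.span_eq
proof (intro conjI subsetI)
  fix \<omega> assume "\<omega> \<in> {monomial_form (\<gamma> + unit_idx j) j | j. j \<in> idx \<gamma>}"
  then obtain p where p: "\<omega> = monomial_form (\<gamma> + unit_idx p) p" "p \<in> idx \<gamma>" by auto
  define s where "s = complex_of_real (sqrt (cc M (\<gamma> + unit_idx p)))"
  have "s \<noteq> 0" using cc_pos[of "\<gamma> + unit_idx p"] p(2) by (simp add: s_def idx_def)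
  then have "\<omega> = form_scale (inverse s) (basis_form \<gamma> p)"
    by (simp add: p basis_form_def flip: s_def)
  then show "\<omega> \<in> form.span (basis_form \<gamma> ` idx \<gamma>)"
    using p(2) by (auto intro: form.span_scale form.span_base)
next
  fix \<omega> assume "\<omega> \<in> basis_form \<gamma> ` idx \<gamma>"
  then show "\<omega> \<in> form.span {monomial_form (\<gamma> + unit_idx j) j | j. j \<in> idx \<gamma>}"
    unfolding basis_form_def by (auto intro!: form.span_scale intro: form.span_base)
qed

lemma dim_E_space: "form.dim (E_space \<gamma>) = card (idx \<gamma>)" for \<gamma> :: "int ^ 'n"
proof -
  have "form.independent (basis_form \<gamma> ` idx \<gamma>)"
    by (rule l2f.independent_orthogonal[where M = M])
      (auto simp: form_inner_basis_form basis_form_in_L2_form split: if_splits)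
  moreover have "inj_on (basis_form \<gamma>) (idx \<gamma>)"
  proof (rule inj_onI)
    fix p q assume "p \<in> idx \<gamma>" "q \<in> idx \<gamma>" "basis_form \<gamma> p = basis_form \<gamma> q"
    then show "p = q" using form_inner_basis_form[of p \<gamma> p \<gamma>] form_inner_basis_form[of p \<gamma> q \<gamma>]
      by (auto split: if_splits)
  qed
  ultimately show ?thesis
    by (simp add: E_space_eq_span_basis_form form.dim_eq_card_independent card_image)
qed

lemma E_space_orthogonal:
  fixes \<gamma> \<gamma>' :: "int ^ 'n"
  assumes "\<gamma> \<noteq> \<gamma>'" "\<omega> \<in> E_space \<gamma>" "\<eta> \<in> E_space \<gamma>'"
  shows "form_inner M \<omega> \<eta> = 0"
  by (rule l2f.orth_span_span[OF _ _ _ assms(2,3)[unfolded E_space_eq_span_basis_form]])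
    (use assms(1) in \<open>auto simp: form_inner_basis_form basis_form_in_L2_form\<close>)

text \<open>
  This is used once for the blocks \<open>E\<^sub>\<gamma>\<close> and once for the lines spanned by the single vectors of a
  diagonalizing basis.
\<close>

lemma A2_form_eq_hilbert_sum:
  assumes fin: "\<And>i. i \<in> I \<Longrightarrow> finite (K i)"
    and on: "\<And>i k i' k'. i \<in> I \<Longrightarrow> k \<in> K i \<Longrightarrow> i' \<in> I \<Longrightarrow> k' \<in> K i' \<Longrightarrow>
      form_inner M (\<phi> i k) (\<phi> i' k') = (if i = i' \<and> k = k' then 1 else 0)"
    and poly: "\<And>i k. i \<in> I \<Longrightarrow> k \<in> K i \<Longrightarrow> \<phi> i k \<in> poly_forms"
    and dense: "\<And>\<alpha> j. 0 \<le> \<alpha> \<Longrightarrow> monomial_form \<alpha> j \<in> form.span (\<Union>i\<in>I. form.span (\<phi> i ` K i))"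
  shows "A2_form M = hilbert_sum M I (\<lambda>i. form.span (\<phi> i ` K i))"
proof -
  have H: "\<phi> i ` K i \<subseteq> L2_form M" if "i \<in> I" for i
    using poly that poly_forms_subset_L2_form by blast
  have "form.span (\<Union>i\<in>I. form.span (\<phi> i ` K i)) \<subseteq> poly_forms"
  proof (rule form.span_minimal)
    show "form.subspace poly_forms" unfolding poly_forms_def by (rule form.subspace_span)
    then show "(\<Union>i\<in>I. form.span (\<phi> i ` K i)) \<subseteq> poly_forms"
      using poly by (intro UN_least form.span_minimal) auto
  qed
  moreover have "poly_forms \<subseteq> form.span (\<Union>i\<in>I. form.span (\<phi> i ` K i))"
    unfolding poly_forms_def
  proof (rule form.span_minimal)
    show "{monomial_form \<alpha> j | \<alpha> j. 0 \<le> \<alpha>} \<subseteq> form.span (\<Union>i\<in>I. form.span (\<phi> i ` K i))"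
      using dense by blast
  qed (rule form.subspace_span)
  ultimately have span: "poly_forms = form.span (\<Union>i\<in>I. form.span (\<phi> i ` K i))" by (rule equalityI[rotated])
  show ?thesis
    unfolding A2_form_eq_closure_in hilbert_sum_eq_orth_sum span
  proof (rule l2f.orth_sum_eq_closure_in[symmetric])
    fix i assume i: "i \<in> I"
    show "form.subspace (form.span (\<phi> i ` K i))" by (rule form.subspace_span)
    show "form.span (\<phi> i ` K i) \<subseteq> L2_form M" by (rule l2f.span_subset_H[OF H[OF i]])
    fix \<omega> assume \<omega>: "\<omega> \<in> L2_form M"
    show "\<exists>p\<in>form.span (\<phi> i ` K i). \<forall>v\<in>form.span (\<phi> i ` K i). form_inner M (\<omega> - p) v = 0"
      using fin[OF i] H[OF i] on[OF i _ i] \<omega> by (intro l2f.orthonormal_projection) auto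
  next
    fix i i' \<omega> \<eta> assume i: "i \<in> I" "i' \<in> I" "i \<noteq> i'"
      and \<omega>: "\<omega> \<in> form.span (\<phi> i ` K i)" and \<eta>: "\<eta> \<in> form.span (\<phi> i' ` K i')"
    have "form_inner M a b = 0" if "a \<in> \<phi> i ` K i" "b \<in> \<phi> i' ` K i'" for a b
      using that on[OF i(1) _ i(2)] i(3) by auto
    then show "form_inner M \<omega> \<eta> = 0"
      using l2f.orth_span_span[OF H[OF i(1)] H[OF i(2)] _ \<omega> \<eta>] by blast
  qed
qed

lemma A2_form_eq_hilbert_sum_E_space: "A2_form M = hilbert_sum M Gamma_set E_space"
  unfolding E_space_eq_span_basis_form
proof (rule A2_form_eq_hilbert_sum)
  fix \<gamma> :: "int ^ 'n" and p assume "p \<in> idx \<gamma>"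
  then show "basis_form \<gamma> p \<in> poly_forms"
    using E_space_subset_poly_forms[of \<gamma>] unfolding E_space_eq_span_basis_form
    by (auto intro: form.span_base)
next
  fix \<alpha> :: "int ^ 'n" and j assume \<alpha>: "0 \<le> \<alpha>"
  show "monomial_form \<alpha> j \<in> form.span (\<Union>\<gamma>\<in>Gamma_set. form.span (basis_form \<gamma> ` idx \<gamma>))"
    using monomial_form_in_E_space[OF \<alpha>, of j] sub_unit_idx_in_Gamma_set[OF \<alpha>, of j]
    unfolding E_space_eq_span_basis_form by (intro form.span_base) blast
qed (simp_all add: form_inner_basis_form)

lemma E_space_subset_A2_form: "E_space \<gamma> \<subseteq> A2_form M"
  using E_space_subset_poly_forms l2f.closure_in_superset[OF poly_forms_subset_L2_form]
  unfolding A2_form_eq_closure_in by blast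

end

section \<open>The canonical solution operator\<close>

lemma l2_inner_cong_AE:
  assumes "f \<in> L2 M" "f' \<in> L2 M" "g \<in> L2 M" "g' \<in> L2 M"
    and "AE z in M. f z = f' z" "AE z in M. g z = g' z"
  shows "l2_inner M f g = l2_inner M f' g'"
  unfolding l2_inner_def
proof (rule Bochner_Integration.integral_cong_AE)
  show "AE z in M. f z * cnj (g z) = f' z * cnj (g' z)"
    using assms(5,6) by eventually_elim simp
qed (intro borel_measurable_integrable L2_mult_integrable assms)+

lemma AE_eq_if_l2_norm_diff_0:
  assumes "f \<in> L2 M" "g \<in> L2 M" "l2_norm M (f - g) = 0"
  shows "AE z in M. f z = g z"
proof -
  have fg: "f - g \<in> L2 M" using assms by auto
  have "(LINT z|M. (cmod ((f - g) z))\<^sup>2) = 0"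
    using assms(3) by (simp add: l2_norm_def)
  then have "AE z in M. (cmod ((f - g) z))\<^sup>2 = 0"
    using integral_nonneg_eq_0_iff_AE[OF L2_integrable[OF fg]] by simp
  then show ?thesis by eventually_elim simp
qed

lemma canonical_solution_operatorD:
  assumes "canonical_solution_operator M S"
  shows canonical_solution_in_L2: "\<omega> \<in> poly_forms \<Longrightarrow> S \<omega> \<in> L2 M"
    and canonical_solution_add: "\<omega> \<in> poly_forms \<Longrightarrow> \<eta> \<in> poly_forms \<Longrightarrow>
      AE z in M. S (\<omega> + \<eta>) z = S \<omega> z + S \<eta> z"
    and canonical_solution_scale: "\<omega> \<in> poly_forms \<Longrightarrow> AE z in M. S (form_scale c \<omega>) z = c * S \<omega> z"
    and canonical_solution_monomial: "0 \<le> \<alpha> \<Longrightarrow>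
      S (monomial_form \<alpha> j) - (\<lambda>z. cnj (z $ j) * monomial \<alpha> z) \<in> A2 M"
    and canonical_solution_orthogonal: "0 \<le> \<alpha> \<Longrightarrow> g \<in> A2 M \<Longrightarrow>
      l2_inner M (S (monomial_form \<alpha> j)) g = 0"
  using assms unfolding canonical_solution_operator_def by simp_all

text \<open>
  Linearity holds only almost everywhere, with an exceptional null set for each instance; finite
  combinations need only finitely many of them.
\<close>

lemma canonical_solution_operator_sum:
  assumes S: "canonical_solution_operator M S" and "finite I"
    and poly: "\<And>i. i \<in> I \<Longrightarrow> \<omega> i \<in> poly_forms"
  shows "AE z in M. S (\<Sum>i\<in>I. form_scale (a i) (\<omega> i)) z = (\<Sum>i\<in>I. a i * S (\<omega> i) z)"
  using assms(2) poly
proof (induction I rule: finite_induct)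
  case empty
  have "(0 :: 'a form) \<in> poly_forms" by (simp add: poly_forms_def form.span_zero)
  then have "AE z in M. S (form_scale 0 (0 :: 'a form)) z = 0 * S 0 z"
    by (rule canonical_solution_scale[OF S])
  then show ?case by (simp only: form.scale_zero_left sum.empty mult_zero_left)
next
  case (insert i I)
  have sub: "form.subspace (poly_forms :: 'a form set)" unfolding poly_forms_def by (rule form.subspace_span)
  have scaled: "form_scale (a k) (\<omega> k) \<in> poly_forms" if "k \<in> insert i I" for k
    by (rule form.subspace_scale[OF sub insert.prems[OF that]])
  have "form_scale (a i) (\<omega> i) \<in> poly_forms" by (rule scaled) simp
  moreover have "(\<Sum>i\<in>I. form_scale (a i) (\<omega> i)) \<in> poly_forms"
    by (rule form.subspace_sum[OF sub scaled]) simp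
  ultimately have "AE z in M. S (form_scale (a i) (\<omega> i) + (\<Sum>i\<in>I. form_scale (a i) (\<omega> i))) z =
      S (form_scale (a i) (\<omega> i)) z + S (\<Sum>i\<in>I. form_scale (a i) (\<omega> i)) z"
    by (rule canonical_solution_add[OF S])
  moreover have "AE z in M. S (form_scale (a i) (\<omega> i)) z = a i * S (\<omega> i) z"
    by (rule canonical_solution_scale[OF S insert.prems]) simp
  moreover have "AE z in M. S (\<Sum>i\<in>I. form_scale (a i) (\<omega> i)) z = (\<Sum>i\<in>I. a i * S (\<omega> i) z)"
    by (rule insert.IH) (rule insert.prems, simp)
  ultimately show ?case
    by eventually_elim (simp only: sum.insert[OF insert.hyps])
qed

context orthogonal_monomials
begin

definition conj_mult :: "'n \<Rightarrow> int ^ 'n \<Rightarrow> complex ^ 'n \<Rightarrow> complex" where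
  "conj_mult p \<alpha> = (\<lambda>z. cnj (z $ p) * monomial \<alpha> z)"

lemma conj_mult_in_L2:
  assumes "0 \<le> \<alpha>"
  shows "conj_mult p \<alpha> \<in> L2 M"
proof -
  have "continuous_on UNIV (conj_mult p \<alpha>)"
    unfolding conj_mult_def
    by (intro continuous_intros continuous_on_monomial[OF assms, unfolded eta_contract_eq])
  then have "conj_mult p \<alpha> \<in> borel_measurable M" by (rule borel_measurable_M)
  moreover have "(cmod (conj_mult p \<alpha> z))\<^sup>2 = (cmod (monomial (\<alpha> + unit_idx p) z))\<^sup>2" for z
    using assms by (simp add: conj_mult_def monomial_add_unit_idx norm_mult)
  then have "integrable M (\<lambda>z. (cmod (conj_mult p \<alpha> z))\<^sup>2)"
    using L2_integrable[OF monomial_in_L2[OF add_unit_idx_nonneg[OF assms, of p]]] by simp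
  ultimately show ?thesis by (simp add: L2_def)
qed

lemma l2_inner_conj_mult_monomial:
  assumes "0 \<le> \<alpha>" "0 \<le> \<beta>"
  shows "l2_inner M (conj_mult p \<alpha>) (monomial \<beta>) =
    (if \<alpha> = \<beta> + unit_idx p then of_real (1 / cc M \<alpha>) else 0)"
proof -
  have "l2_inner M (conj_mult p \<alpha>) (monomial \<beta>) = l2_inner M (monomial \<alpha>) (monomial (\<beta> + unit_idx p))"
    unfolding l2_inner_def using assms
    by (simp add: conj_mult_def monomial_add_unit_idx mult_ac)
  then show ?thesis using assms by (simp add: l2_inner_monomial add_unit_idx_nonneg)
qed

lemma l2_inner_conj_mult_conj_mult:
  assumes "0 \<le> \<alpha>" "0 \<le> \<beta>"
  shows "l2_inner M (conj_mult p \<alpha>) (conj_mult q \<beta>) =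
    (if \<alpha> + unit_idx q = \<beta> + unit_idx p then of_real (1 / cc M (\<alpha> + unit_idx q)) else 0)"
proof -
  have "l2_inner M (conj_mult p \<alpha>) (conj_mult q \<beta>) =
      l2_inner M (monomial (\<alpha> + unit_idx q)) (monomial (\<beta> + unit_idx p))"
    unfolding l2_inner_def using assms
    by (simp add: conj_mult_def monomial_add_unit_idx mult_ac)
  then show ?thesis using assms by (simp add: l2_inner_monomial add_unit_idx_nonneg)
qed

text \<open>
  The dual basis of the monomials. It is defined for all integer exponents: if some entry of \<open>\<gamma>\<close> is
  negative, then \<open>c \<gamma> = 0\<close>, and the function is zero rather than a Laurent monomial. This
  treats the two kinds of elements of \<open>\<Gamma>\<close> in the same way.
\<close>

definition dual_monomial :: "int ^ 'n \<Rightarrow> complex ^ 'n \<Rightarrow> complex" where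
  "dual_monomial \<gamma> = fun_scale (of_real (cc M \<gamma>)) (monomial \<gamma>)"

lemma dual_monomial_eq_0: "\<not> 0 \<le> \<gamma> \<Longrightarrow> dual_monomial \<gamma> = 0"
  by (simp add: dual_monomial_def cc_def)

lemma subspace_A2: "fn.subspace (A2 M)"
  unfolding A2_eq_closure_in
  by (intro l2.subspace_closure_in fn.subspace_span l2.span_subset_H) (auto simp: monomial_in_L2)

lemma monomial_in_A2:
  assumes "0 \<le> \<alpha>"
  shows "monomial \<alpha> \<in> A2 M"
proof -
  have "fn.span {monomial \<alpha> | \<alpha>. 0 \<le> \<alpha>} \<subseteq> L2 M"
    by (rule l2.span_subset_H) (auto simp: monomial_in_L2)
  moreover have "monomial \<alpha> \<in> fn.span {monomial \<alpha> | \<alpha>. 0 \<le> \<alpha>}"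
    using assms by (intro fn.span_base) auto
  ultimately show ?thesis
    unfolding A2_eq_closure_in using l2.closure_in_superset by blast
qed

lemma dual_monomial_in_A2: "dual_monomial \<gamma> \<in> A2 M"
proof (cases "0 \<le> \<gamma>")
  case True
  then show ?thesis
    unfolding dual_monomial_def by (intro fn.subspace_scale[OF subspace_A2] monomial_in_A2)
next
  case False
  show ?thesis
    unfolding dual_monomial_eq_0[OF False] by (rule fn.subspace_0[OF subspace_A2])
qed

lemma A2_subset_L2: "A2 M \<subseteq> L2 M"
  by (auto simp: A2_def)

lemma l2_inner_dual_monomial:
  assumes "0 \<le> \<beta>"
  shows "l2_inner M (dual_monomial \<gamma>) (monomial \<beta>) = (if \<gamma> = \<beta> then 1 else 0)"
proof (cases "0 \<le> \<gamma>")
  case True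
  then show ?thesis
    using assms cc_pos[OF assms]
    by (simp add: dual_monomial_def l2.ip_scale_left monomial_in_L2 l2_inner_monomial)
next
  case False
  then show ?thesis using assms by (auto simp: dual_monomial_eq_0 monomial_in_L2)
qed

lemma l2_inner_dual_monomial_conj_mult:
  assumes \<beta>: "0 \<le> \<beta>"
  shows "l2_inner M (dual_monomial \<gamma>) (conj_mult q \<beta>) =
    (if \<beta> = \<gamma> + unit_idx q then of_real (cc M \<gamma> / cc M \<beta>) else 0)"
proof (cases "0 \<le> \<gamma>")
  case True
  then have "l2_inner M (dual_monomial \<gamma>) (conj_mult q \<beta>) =
      of_real (cc M \<gamma>) * cnj (l2_inner M (conj_mult q \<beta>) (monomial \<gamma>))"
    using \<beta> l2.ip_commute[OF conj_mult_in_L2[OF \<beta>, of q] monomial_in_L2[OF True]]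
    by (simp add: dual_monomial_def l2.ip_scale_left monomial_in_L2 conj_mult_in_L2)
  then show ?thesis using \<beta> True by (simp add: l2_inner_conj_mult_monomial)
next
  case False
  then show ?thesis using \<beta> by (auto simp: dual_monomial_eq_0 conj_mult_in_L2 cc_def)
qed

text \<open>
  Subtracting from \<open>cnj z\<^sub>p z\<^sup>\<alpha>\<close> its projection to the Bergman space, which is a multiple of the
  monomial with exponent \<open>\<alpha> - e\<^sub>p\<close>, or zero if \<open>\<alpha>\<close> does not involve \<open>z\<^sub>p\<close>.
\<close>

definition solution :: "int ^ 'n \<Rightarrow> 'n \<Rightarrow> complex ^ 'n \<Rightarrow> complex" where
  "solution \<alpha> p = conj_mult p \<alpha> - fun_scale (of_real (1 / cc M \<alpha>)) (dual_monomial (\<alpha> - unit_idx p))"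

lemma solution_in_L2: "0 \<le> \<alpha> \<Longrightarrow> solution \<alpha> p \<in> L2 M"
  unfolding solution_def
  using conj_mult_in_L2 dual_monomial_in_A2 A2_subset_L2 by (intro l2.H_closed) blast+

lemma solution_diff_conj_mult_in_A2: "solution \<alpha> p - conj_mult p \<alpha> \<in> A2 M"
proof -
  have "solution \<alpha> p - conj_mult p \<alpha> =
      fun_scale (- of_real (1 / cc M \<alpha>)) (dual_monomial (\<alpha> - unit_idx p))"
    by (simp add: solution_def fun_scale_def fun_eq_iff)
  then show ?thesis
    using fn.subspace_scale[OF subspace_A2 dual_monomial_in_A2] by (simp only:)
qed

lemma solution_orthogonal_A2:
  assumes \<alpha>: "0 \<le> \<alpha>" and g: "g \<in> A2 M"
  shows "l2_inner M (solution \<alpha> p) g = 0"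
proof (rule l2.orth_closure_in[OF solution_in_L2[OF \<alpha>] _ _ g[unfolded A2_eq_closure_in]])
  show "fn.span {monomial \<alpha> | \<alpha>. 0 \<le> \<alpha>} \<subseteq> L2 M"
    by (rule l2.span_subset_H) (auto simp: monomial_in_L2)
  fix v :: "complex ^ 'n \<Rightarrow> complex"
  assume v: "v \<in> fn.span {monomial \<alpha> | \<alpha>. 0 \<le> \<alpha>}"
  show "l2_inner M (solution \<alpha> p) v = 0"
  proof (rule l2.orth_span[OF solution_in_L2[OF \<alpha>] _ _ v])
    fix b :: "complex ^ 'n \<Rightarrow> complex" assume "b \<in> {monomial \<alpha> | \<alpha>. 0 \<le> \<alpha>}"
    then obtain \<beta> where b: "b = monomial \<beta>" "0 \<le> \<beta>" by auto
    have L2: "conj_mult p \<alpha> \<in> L2 M" "dual_monomial (\<alpha> - unit_idx p) \<in> L2 M" "monomial \<beta> \<in> L2 M"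
      using \<alpha> b dual_monomial_in_A2 A2_subset_L2 by (auto simp: conj_mult_in_L2 monomial_in_L2)
    have "\<alpha> = \<beta> + unit_idx p \<longleftrightarrow> \<alpha> - unit_idx p = \<beta>" by (auto simp: algebra_simps)
    then show "l2_inner M (solution \<alpha> p) b = 0"
      unfolding solution_def b using L2 \<alpha> b
      by (simp add: l2.ip_diff_left l2.ip_scale_left l2.H_closed l2_inner_conj_mult_monomial
          l2_inner_dual_monomial)
  qed (auto simp: monomial_in_L2)
qed

text \<open>
  Only one of the two correction terms contributes, because the first solution is orthogonal to
  the correction term of the second one. In the remaining inner products the factors
  \<open>cnj z\<^sub>p\<close> and \<open>cnj z\<^sub>q\<close> are moved to the other side, and the orthogonality of the monomials leaves
  only \<open>\<gamma> = \<gamma>'\<close>.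
\<close>

lemma l2_inner_solution:
  assumes p: "p \<in> idx \<gamma>" and q: "q \<in> idx \<gamma>'"
  shows "l2_inner M (solution (\<gamma> + unit_idx p) p) (solution (\<gamma>' + unit_idx q) q) =
    (if \<gamma> = \<gamma>' then of_real (1 / cc M (\<gamma> + unit_idx p + unit_idx q) -
       cc M \<gamma> / (cc M (\<gamma> + unit_idx p) * cc M (\<gamma> + unit_idx q))) else 0)"
proof -
  define \<alpha> \<beta> where "\<alpha> = \<gamma> + unit_idx p" and "\<beta> = \<gamma>' + unit_idx q"
  have pos: "0 \<le> \<alpha>" "0 \<le> \<beta>" using p q by (auto simp: idx_def \<alpha>_def \<beta>_def)
  have A2: "dual_monomial \<delta> \<in> L2 M" for \<delta> using dual_monomial_in_A2 A2_subset_L2 by blast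
  have "l2_inner M (solution \<alpha> p) (solution \<beta> q) = l2_inner M (solution \<alpha> p) (conj_mult q \<beta>)"
    using pos A2 unfolding solution_def[of \<beta> q]
    by (simp add: l2.ip_diff_right l2.ip_scale_right l2.H_closed solution_in_L2 conj_mult_in_L2
        solution_orthogonal_A2[OF _ dual_monomial_in_A2])
  also have "\<dots> = l2_inner M (conj_mult p \<alpha>) (conj_mult q \<beta>) -
      of_real (1 / cc M \<alpha>) * l2_inner M (dual_monomial \<gamma>) (conj_mult q \<beta>)"
    using pos A2 unfolding solution_def
    by (simp add: l2.ip_diff_left l2.ip_scale_left l2.H_closed conj_mult_in_L2 \<alpha>_def)
  also have "\<dots> = (if \<gamma> = \<gamma>' then of_real (1 / cc M (\<alpha> + unit_idx q) - cc M \<gamma> / (cc M \<alpha> * cc M \<beta>)) else 0)"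
    using pos by (auto simp: l2_inner_conj_mult_conj_mult l2_inner_dual_monomial_conj_mult \<alpha>_def \<beta>_def add_ac)
  finally show ?thesis by (auto simp: \<alpha>_def \<beta>_def)
qed

text \<open>
  The monomial forms are orthogonal, hence linearly independent, so the values prescribed on them
  extend linearly, to the space of all forms.
\<close>

lemma exists_canonical_solution_operator: "\<exists>S. canonical_solution_operator M S"
proof -
  define B where "B = {monomial_form \<alpha> j | \<alpha> (j :: 'n). 0 \<le> \<alpha>}"
  define h where "h \<omega> = (SOME f. \<exists>\<alpha> j. \<omega> = monomial_form \<alpha> j \<and> 0 \<le> \<alpha> \<and> f = solution \<alpha> j)"
    for \<omega> :: "'n form"
  have h: "h (monomial_form \<alpha> j) = solution \<alpha> j" if "0 \<le> \<alpha>" for \<alpha> j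
  proof -
    have "\<exists>f \<beta> k. monomial_form \<alpha> j = monomial_form \<beta> k \<and> 0 \<le> \<beta> \<and> f = solution \<beta> k"
      using that by blast
    from someI_ex[OF this] obtain \<beta> k where
      "monomial_form \<alpha> j = monomial_form \<beta> k" "0 \<le> \<beta>" "h (monomial_form \<alpha> j) = solution \<beta> k"
      unfolding h_def by blast
    then show ?thesis using inj_monomial_form[OF that] by metis
  qed
  interpret fs: vector_space_pair form_scale "fun_scale :: complex \<Rightarrow> (complex ^ 'n \<Rightarrow> complex) \<Rightarrow> _"
    by unfold_locales
  obtain S where S: "Vector_Spaces.linear form_scale fun_scale S" and S_B: "\<forall>\<omega>\<in>B. S \<omega> = h \<omega>"
    using fs.linear_independent_extend[OF independent_monomial_forms, of h] unfolding B_def by blast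
  have S_monomial: "S (monomial_form \<alpha> j) = solution \<alpha> j" if "0 \<le> \<alpha>" for \<alpha> j
  proof -
    have "monomial_form \<alpha> j \<in> B" using that unfolding B_def by blast
    then show ?thesis using S_B h[OF that, of j] by simp
  qed
  interpret S: Vector_Spaces.linear form_scale fun_scale S by (rule S)
  have "S \<omega> \<in> L2 M" if "\<omega> \<in> poly_forms" for \<omega>
    using that unfolding poly_forms_def
  proof (induction rule: form.span_induct_alt)
    case (step c x y)
    then obtain \<alpha> j where x: "x = monomial_form \<alpha> j" "0 \<le> \<alpha>" by auto
    have "S (form_scale c x + y) = fun_scale c (solution \<alpha> j) + S y"
      by (simp only: S.add S.scale x S_monomial)
    then show ?case using step.IH solution_in_L2[OF x(2)] by (simp only: l2.H_closed)
  next
    case base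
    show ?case unfolding S.zero by (rule l2.H_closed)
  qed
  moreover have "S (\<omega> + \<eta>) z = S \<omega> z + S \<eta> z" for \<omega> \<eta> z
    unfolding S.add by simp
  moreover have "S (form_scale c \<omega>) z = c * S \<omega> z" for c \<omega> z
    unfolding S.scale by (simp add: fun_scale_def)
  ultimately have "canonical_solution_operator M S"
    unfolding canonical_solution_operator_def
    using solution_diff_conj_mult_in_A2 solution_orthogonal_A2
    by (auto simp: S_monomial simp flip: conj_mult_def)
  then show ?thesis by blast
qed

text \<open>
  The canonical solution is unique in \<open>L\<^sup>2\<close>: the difference of two of them lies in the Bergman
  space and is orthogonal to it.
\<close>

lemma canonical_solution_monomial_form:
  assumes S: "canonical_solution_operator M S" and \<alpha>: "0 \<le> \<alpha>"
  shows "AE z in M. S (monomial_form \<alpha> j) z = solution \<alpha> j z"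
proof -
  have "monomial_form \<alpha> j \<in> poly_forms"
    using \<alpha> unfolding poly_forms_def by (intro form.span_base) auto
  then have L2: "S (monomial_form \<alpha> j) \<in> L2 M" by (rule canonical_solution_in_L2[OF S])
  define d where "d = S (monomial_form \<alpha> j) - solution \<alpha> j"
  have "S (monomial_form \<alpha> j) - conj_mult j \<alpha> \<in> A2 M"
    unfolding conj_mult_def by (rule canonical_solution_monomial[OF S \<alpha>])
  then have "(S (monomial_form \<alpha> j) - conj_mult j \<alpha>) - (solution \<alpha> j - conj_mult j \<alpha>) \<in> A2 M"
    by (rule fn.subspace_diff[OF subspace_A2 _ solution_diff_conj_mult_in_A2])
  then have d: "d \<in> A2 M" by (simp add: d_def)
  have "l2_inner M (S (monomial_form \<alpha> j)) d = 0"
    by (rule canonical_solution_orthogonal[OF S \<alpha> d])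
  moreover have "l2_inner M (solution \<alpha> j) d = 0" by (rule solution_orthogonal_A2[OF \<alpha> d])
  ultimately have "l2_inner M d d = 0"
    unfolding d_def using L2 solution_in_L2[OF \<alpha>]
    by (subst l2.ip_diff_left) (auto simp: l2.H_closed)
  then have "l2_norm M d = 0" by (simp add: l2_inner_self)
  then show ?thesis
    using AE_eq_if_l2_norm_diff_0[OF L2 solution_in_L2[OF \<alpha>]] by (simp add: d_def)
qed

lemma l2_inner_canonical_solution:
  assumes S: "canonical_solution_operator M S"
  shows "l2_inner M (S (\<Sum>p\<in>idx \<gamma>. form_scale (a p) (monomial_form (\<gamma> + unit_idx p) p)))
      (S (\<Sum>q\<in>idx \<gamma>'. form_scale (b q) (monomial_form (\<gamma>' + unit_idx q) q))) =
    (\<Sum>p\<in>idx \<gamma>. \<Sum>q\<in>idx \<gamma>'. a p * cnj (b q) *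
      l2_inner M (solution (\<gamma> + unit_idx p) p) (solution (\<gamma>' + unit_idx q) q))"
proof -
  let ?m = "\<lambda>\<gamma> p. monomial_form (\<gamma> + unit_idx p) p"
  let ?s = "\<lambda>\<gamma> p. solution (\<gamma> + unit_idx p) p"
  have sub: "form.subspace (poly_forms :: 'n form set)"
    unfolding poly_forms_def by (rule form.subspace_span)
  have m: "?m \<gamma> p \<in> poly_forms" if "p \<in> idx \<gamma>" for \<gamma> :: "int ^ 'n" and p
    using that unfolding poly_forms_def idx_def by (intro form.span_base) blast
  have s: "?s \<gamma> p \<in> L2 M" if "p \<in> idx \<gamma>" for \<gamma> p
    using that solution_in_L2 by (auto simp: idx_def)
  have L2: "S (\<Sum>p\<in>idx \<gamma>. form_scale (a p) (?m \<gamma> p)) \<in> L2 M" for a and \<gamma> :: "int ^ 'n"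
  proof -
    have "(\<Sum>p\<in>idx \<gamma>. form_scale (a p) (?m \<gamma> p)) \<in> poly_forms"
      by (intro form.subspace_sum[OF sub] form.subspace_scale[OF sub] m)
    then show ?thesis by (rule canonical_solution_in_L2[OF S])
  qed
  have AE: "AE z in M. S (\<Sum>p\<in>idx \<gamma>. form_scale (a p) (?m \<gamma> p)) z =
      (\<Sum>p\<in>idx \<gamma>. fun_scale (a p) (?s \<gamma> p)) z" for a \<gamma>
  proof -
    have "AE z in M. S (\<Sum>p\<in>idx \<gamma>. form_scale (a p) (?m \<gamma> p)) z = (\<Sum>p\<in>idx \<gamma>. a p * S (?m \<gamma> p) z)"
      using m by (intro canonical_solution_operator_sum[OF S]) auto
    moreover have "AE z in M. \<forall>p\<in>idx \<gamma>. S (?m \<gamma> p) z = ?s \<gamma> p z"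
      by (intro AE_finite_allI) (auto simp: idx_def intro!: canonical_solution_monomial_form[OF S])
    ultimately show ?thesis
      by eventually_elim (simp add: sum_fun_apply fun_scale_def)
  qed
  have L2': "(\<Sum>p\<in>idx \<gamma>. fun_scale (a p) (?s \<gamma> p)) \<in> L2 M" for a \<gamma>
    using s by (intro l2.sum_in_H l2.H_closed)
  show ?thesis
    unfolding l2_inner_cong_AE[OF L2 L2' L2 L2' AE AE]
    by (intro l2.ip_lincomb s)
qed

end

section \<open>Diagonalization\<close>

context orthogonal_monomials
begin

lemma C_entry_commute: "C_entry M \<gamma> p q = C_entry M \<gamma> q p"
  by (simp add: C_entry_def mult.commute add_ac)

text \<open>
  The right-hand side is the inner product of the solutions for two normalized monomial forms of
  \<open>E\<^sub>\<gamma>\<close>.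
\<close>

lemma C_entry_eq:
  assumes "p \<in> idx \<gamma>" "q \<in> idx \<gamma>"
  shows "C_entry M \<gamma> p q = sqrt (cc M (\<gamma> + unit_idx p)) * sqrt (cc M (\<gamma> + unit_idx q)) *
    (1 / cc M (\<gamma> + unit_idx p + unit_idx q) - cc M \<gamma> / (cc M (\<gamma> + unit_idx p) * cc M (\<gamma> + unit_idx q)))"
proof -
  have pos: "0 < cc M (\<gamma> + unit_idx p)" "0 < cc M (\<gamma> + unit_idx q)" "0 < cc M (\<gamma> + unit_idx p + unit_idx q)"
    using assms by (auto simp: idx_def intro!: cc_pos add_unit_idx_nonneg)
  have key: "(a * b - c * d) / (d * sqrt (a * b)) = sqrt a * sqrt b * (1 / d - c / (a * b))"
    if "0 < a" "0 < b" "0 < d" for a b c d :: real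
  proof -
    define s where "s = sqrt a * sqrt b"
    have s: "s \<noteq> 0" "a * b = s * s" "sqrt (a * b) = s"
      using that by (auto simp: s_def real_sqrt_mult mult_ac simp flip: mult.assoc)
    have "(s * s - c * d) / (d * s) = s * (1 / d - c / (s * s))"
      using s(1) \<open>0 < d\<close> by (simp add: diff_divide_distrib right_diff_distrib)
    then show ?thesis unfolding s(3) unfolding s(2) s_def[symmetric] .
  qed
  show ?thesis unfolding C_entry_def by (rule key[OF pos])
qed

lemma C_entry_diag:
  assumes "p \<in> idx \<gamma>"
  shows "C_entry M \<gamma> p p =
    cc M (\<gamma> + unit_idx p) / cc M (\<gamma> + 2 *s unit_idx p) - cc M \<gamma> / cc M (\<gamma> + unit_idx p)"
proof -
  have "0 < cc M (\<gamma> + unit_idx p)" using assms by (auto simp: idx_def intro!: cc_pos)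
  moreover have "sqrt c * sqrt c * (1 / d - e / (c * c)) = c / d - e / c" if "0 < c" for c d e :: real
    using that by (simp add: right_diff_distrib)
  moreover have "\<gamma> + 2 *s unit_idx p = \<gamma> + unit_idx p + unit_idx p"
    by (simp add: vec_eq_iff)
  ultimately show ?thesis
    unfolding C_entry_eq[OF assms assms] by (simp only:)
qed

text \<open>
  The vectors \<open>\<phi> j\<close> have the eigenvectors of \<open>C\<^sub>\<gamma>\<close> as coordinates with respect to the normalized
  monomial forms. Since \<open>C\<^sub>\<gamma>\<close> is the Gram matrix of the solutions for these forms,
  it becomes diagonal in the new basis.
\<close>

lemma eigenbasis_E_space:
  assumes S: "canonical_solution_operator M S"
  shows "\<exists>\<phi> ev. (\<forall>j\<in>{1..card (idx \<gamma>)}. \<forall>k\<in>{1..card (idx \<gamma>)}.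
        form_inner M (\<phi> j) (\<phi> k) = (if j = k then 1 else 0)) \<and>
      form.span (\<phi> ` {1..card (idx \<gamma>)}) = E_space \<gamma> \<and>
      (\<forall>j\<in>{1..card (idx \<gamma>)}. \<forall>k\<in>{1..card (idx \<gamma>)}.
        l2_inner M (S (\<phi> j)) (S (\<phi> k)) = of_real (if j = k then ev j else 0)) \<and>
      (\<forall>b. bij_betw b {..<card (idx \<gamma>)} (idx \<gamma>) \<longrightarrow>
        proots (char_poly (enum_mat (card (idx \<gamma>)) b (C_entry M \<gamma>))) =
        image_mset ev (mset_set {1..card (idx \<gamma>)})) \<and>
      (\<Sum>j=1..card (idx \<gamma>). ev j) = (\<Sum>p\<in>idx \<gamma>. C_entry M \<gamma> p p)"
proof (rule symmetric_array_eigenbasis[of "idx \<gamma>" "C_entry M \<gamma>", OF C_entry_commute])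
  let ?d = "card (idx \<gamma>)"
  fix u :: "nat \<Rightarrow> 'n \<Rightarrow> real" and ev :: "nat \<Rightarrow> real"
  assume on: "\<And>j k. j \<in> {1..?d} \<Longrightarrow> k \<in> {1..?d} \<Longrightarrow> (\<Sum>p\<in>idx \<gamma>. u j p * u k p) = (if j = k then 1 else 0)"
    and complete: "\<And>p q. p \<in> idx \<gamma> \<Longrightarrow> q \<in> idx \<gamma> \<Longrightarrow> (\<Sum>j=1..?d. u j p * u j q) = (if p = q then 1 else 0)"
    and eigen: "\<And>j p. j \<in> {1..?d} \<Longrightarrow> p \<in> idx \<gamma> \<Longrightarrow> (\<Sum>q\<in>idx \<gamma>. C_entry M \<gamma> p q * u j q) = ev j * u j p"
  define \<phi> where "\<phi> j = (\<Sum>p\<in>idx \<gamma>. form_scale (of_real (u j p)) (basis_form \<gamma> p))" for j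
  have \<phi>_monomial: "\<phi> j = (\<Sum>p\<in>idx \<gamma>. form_scale (of_real (u j p * sqrt (cc M (\<gamma> + unit_idx p))))
      (monomial_form (\<gamma> + unit_idx p) p))" for j
    unfolding \<phi>_def basis_form_def by simp
  have "form_inner M (\<phi> j) (\<phi> k) = (if j = k then 1 else 0)" if jk: "j \<in> {1..?d}" "k \<in> {1..?d}" for j k
  proof -
    have "form_inner M (\<phi> j) (\<phi> k) =
        (\<Sum>p\<in>idx \<gamma>. \<Sum>q\<in>idx \<gamma>. of_real (u j p) * cnj (of_real (u k q)) * form_inner M (basis_form \<gamma> p) (basis_form \<gamma> q))"
      unfolding \<phi>_def by (intro l2f.ip_lincomb basis_form_in_L2_form)
    also have "\<dots> = (\<Sum>p\<in>idx \<gamma>. \<Sum>q\<in>idx \<gamma>. if p = q then of_real (u j p * u k q) else 0)"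
      by (intro sum.cong refl) (simp add: form_inner_basis_form)
    also have "\<dots> = of_real (\<Sum>p\<in>idx \<gamma>. u j p * u k p)" by simp
    finally show ?thesis using on[OF jk] by simp
  qed
  moreover have "form.span (\<phi> ` {1..?d}) = E_space \<gamma>"
    unfolding E_space_eq_span_basis_form form.span_eq
  proof (intro conjI subsetI)
    fix \<omega> assume "\<omega> \<in> \<phi> ` {1..?d}"
    then show "\<omega> \<in> form.span (basis_form \<gamma> ` idx \<gamma>)"
      unfolding \<phi>_def by (auto intro!: form.span_sum form.span_scale intro: form.span_base)
  next
    fix \<omega> assume "\<omega> \<in> basis_form \<gamma> ` idx \<gamma>"
    then obtain p where p: "p \<in> idx \<gamma>" "\<omega> = basis_form \<gamma> p" by auto
    \<comment> \<open>An orthogonal matrix is inverted by its transpose.\<close>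
    have "(\<Sum>j=1..?d. form_scale (of_real (u j p)) (\<phi> j)) =
        (\<Sum>j=1..?d. \<Sum>q\<in>idx \<gamma>. form_scale (of_real (u j p * u j q)) (basis_form \<gamma> q))"
      unfolding \<phi>_def by (simp add: form.scale_sum_right)
    also have "\<dots> = (\<Sum>q\<in>idx \<gamma>. form_scale (of_real (\<Sum>j=1..?d. u j p * u j q)) (basis_form \<gamma> q))"
      by (subst sum.swap) (simp add: form.scale_sum_left)
    also have "\<dots> = (\<Sum>q\<in>idx \<gamma>. if p = q then basis_form \<gamma> q else 0)"
      using complete[OF p(1)] by (intro sum.cong refl) simp
    also have "\<dots> = \<omega>" using p by simp
    finally have "\<omega> = (\<Sum>j=1..?d. form_scale (of_real (u j p)) (\<phi> j))" by (rule sym)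
    moreover have "(\<Sum>j=1..?d. form_scale (of_real (u j p)) (\<phi> j)) \<in> form.span (\<phi> ` {1..?d})"
      by (intro form.span_sum form.span_scale form.span_base imageI)
    ultimately show "\<omega> \<in> form.span (\<phi> ` {1..?d})" by (simp only:)
  qed
  moreover have "l2_inner M (S (\<phi> j)) (S (\<phi> k)) = of_real (if j = k then ev j else 0)"
    if jk: "j \<in> {1..?d}" "k \<in> {1..?d}" for j k
  proof -
    have "l2_inner M (S (\<phi> j)) (S (\<phi> k)) = (\<Sum>p\<in>idx \<gamma>. \<Sum>q\<in>idx \<gamma>. of_real (u j p * (C_entry M \<gamma> p q * u k q)))"
      unfolding \<phi>_monomial l2_inner_canonical_solution[OF S]
      by (intro sum.cong refl) (simp add: l2_inner_solution C_entry_eq mult_ac)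
    also have "\<dots> = of_real (\<Sum>p\<in>idx \<gamma>. u j p * (\<Sum>q\<in>idx \<gamma>. C_entry M \<gamma> p q * u k q))"
      by (simp add: sum_distrib_left)
    also have "(\<Sum>p\<in>idx \<gamma>. u j p * (\<Sum>q\<in>idx \<gamma>. C_entry M \<gamma> p q * u k q)) =
        (\<Sum>p\<in>idx \<gamma>. ev k * (u j p * u k p))"
      using eigen[OF jk(2)] by (intro sum.cong refl) simp
    also have "\<dots> = ev k * (\<Sum>p\<in>idx \<gamma>. u j p * u k p)" by (simp add: sum_distrib_left)
    also have "\<dots> = (if j = k then ev j else 0)" using on[OF jk] by simp
    finally show ?thesis .
  qed
  moreover have "proots (char_poly (enum_mat ?d b (C_entry M \<gamma>))) = image_mset ev (mset_set {1..?d})"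
    if "bij_betw b {..<?d} (idx \<gamma>)" for b
    by (rule proots_char_poly_enum_mat[OF that on complete eigen])
  moreover have "(\<Sum>j=1..?d. ev j) = (\<Sum>p\<in>idx \<gamma>. C_entry M \<gamma> p p)"
    by (rule sum_eigenvalues_eq_trace[OF _ _ complete eigen]) (simp_all add: on)
  ultimately show ?thesis by (intro exI[of _ \<phi>] exI[of _ ev] conjI ballI allI impI)
qed

lemma canonical_solution_E_space_orthogonal:
  assumes S: "canonical_solution_operator M S"
    and "\<gamma> \<noteq> \<gamma>'" "\<omega> \<in> E_space \<gamma>" "\<eta> \<in> E_space \<gamma>'"
  shows "l2_inner M (S \<omega>) (S \<eta>) = 0"
proof -
  obtain a where a: "\<omega> = (\<Sum>p\<in>idx \<gamma>. form_scale (a p) (monomial_form (\<gamma> + unit_idx p) p))"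
    using E_space_coords[OF assms(3)] by (rule exE)
  obtain b where b: "\<eta> = (\<Sum>q\<in>idx \<gamma>'. form_scale (b q) (monomial_form (\<gamma>' + unit_idx q) q))"
    using E_space_coords[OF assms(4)] by (rule exE)
  show ?thesis
    unfolding a b l2_inner_canonical_solution[OF S] using assms(2) by (simp add: l2_inner_solution)
qed

lemma exists_diagonalizing_basis:
  assumes S: "canonical_solution_operator M S"
  shows "\<exists>\<phi>. let J = (SIGMA \<gamma>:Gamma_set. {1..form.dim (E_space \<gamma>)}) in
         (\<forall>\<gamma>\<in>Gamma_set. orthonormal M {1..form.dim (E_space \<gamma>)} (\<phi> \<gamma>) \<and>
                   form.span (\<phi> \<gamma> ` {1..form.dim (E_space \<gamma>)}) = E_space \<gamma>) \<and>
         orthonormal M J (\<lambda>(\<gamma>, j). \<phi> \<gamma> j) \<and>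
         A2_form M = hilbert_sum M J (\<lambda>(\<gamma>, j). form.span {\<phi> \<gamma> j}) \<and>
         (\<forall>(\<gamma>, j)\<in>J. \<forall>(\<gamma>', k)\<in>J. (\<gamma>, j) \<noteq> (\<gamma>', k) \<longrightarrow>
            l2_inner M (S (\<phi> \<gamma> j)) (S (\<phi> \<gamma>' k)) = 0) \<and>
         (\<forall>\<gamma>\<in>Gamma_set. \<forall>b. bij_betw b {..<card (idx \<gamma>)} (idx \<gamma>) \<longrightarrow>
            image_mset (\<lambda>j. l2_norm M (S (\<phi> \<gamma> j))) (mset_set {1..form.dim (E_space \<gamma>)}) =
            image_mset sqrt (proots (char_poly (enum_mat (card (idx \<gamma>)) b (C_entry M \<gamma>))))) \<and>
         (\<forall>\<gamma>\<in>Gamma_set.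
            (\<Sum>j=1..form.dim (E_space \<gamma>). (l2_norm M (S (\<phi> \<gamma> j)))\<^sup>2) = (\<Sum>p\<in>idx \<gamma>. C_entry M \<gamma> p p) \<and>
            (\<Sum>p\<in>idx \<gamma>. C_entry M \<gamma> p p) =
            (\<Sum>p\<in>idx \<gamma>. cc M (\<gamma> + unit_idx p) / cc M (\<gamma> + 2 *s unit_idx p) - cc M \<gamma> / cc M (\<gamma> + unit_idx p)))"
proof -
  let ?d = "\<lambda>\<gamma> :: int ^ 'n. card (idx \<gamma>)"
  from choice[OF allI[OF eigenbasis_E_space[OF S]]] obtain \<phi> where
    "\<forall>\<gamma>. \<exists>ev. (\<forall>j\<in>{1..?d \<gamma>}. \<forall>k\<in>{1..?d \<gamma>}. form_inner M (\<phi> \<gamma> j) (\<phi> \<gamma> k) = (if j = k then 1 else 0)) \<and>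
      form.span (\<phi> \<gamma> ` {1..?d \<gamma>}) = E_space \<gamma> \<and>
      (\<forall>j\<in>{1..?d \<gamma>}. \<forall>k\<in>{1..?d \<gamma>}. l2_inner M (S (\<phi> \<gamma> j)) (S (\<phi> \<gamma> k)) = of_real (if j = k then ev j else 0)) \<and>
      (\<forall>b. bij_betw b {..<?d \<gamma>} (idx \<gamma>) \<longrightarrow>
        proots (char_poly (enum_mat (?d \<gamma>) b (C_entry M \<gamma>))) = image_mset ev (mset_set {1..?d \<gamma>})) \<and>
      (\<Sum>j=1..?d \<gamma>. ev j) = (\<Sum>p\<in>idx \<gamma>. C_entry M \<gamma> p p)" ..
  from choice[OF this] obtain ev where \<phi>_ev:
    "\<forall>\<gamma>. (\<forall>j\<in>{1..?d \<gamma>}. \<forall>k\<in>{1..?d \<gamma>}. form_inner M (\<phi> \<gamma> j) (\<phi> \<gamma> k) = (if j = k then 1 else 0)) \<and>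
      form.span (\<phi> \<gamma> ` {1..?d \<gamma>}) = E_space \<gamma> \<and>
      (\<forall>j\<in>{1..?d \<gamma>}. \<forall>k\<in>{1..?d \<gamma>}. l2_inner M (S (\<phi> \<gamma> j)) (S (\<phi> \<gamma> k)) = of_real (if j = k then ev \<gamma> j else 0)) \<and>
      (\<forall>b. bij_betw b {..<?d \<gamma>} (idx \<gamma>) \<longrightarrow>
        proots (char_poly (enum_mat (?d \<gamma>) b (C_entry M \<gamma>))) = image_mset (ev \<gamma>) (mset_set {1..?d \<gamma>})) \<and>
      (\<Sum>j=1..?d \<gamma>. ev \<gamma> j) = (\<Sum>p\<in>idx \<gamma>. C_entry M \<gamma> p p)" ..
  then have on: "\<And>\<gamma> j k. j \<in> {1..?d \<gamma>} \<Longrightarrow> k \<in> {1..?d \<gamma>} \<Longrightarrow>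
        form_inner M (\<phi> \<gamma> j) (\<phi> \<gamma> k) = (if j = k then 1 else 0)"
    and span: "\<And>\<gamma>. form.span (\<phi> \<gamma> ` {1..?d \<gamma>}) = E_space \<gamma>"
    and S_\<phi>: "\<And>\<gamma> j k. j \<in> {1..?d \<gamma>} \<Longrightarrow> k \<in> {1..?d \<gamma>} \<Longrightarrow>
        l2_inner M (S (\<phi> \<gamma> j)) (S (\<phi> \<gamma> k)) = of_real (if j = k then ev \<gamma> j else 0)"
    and roots: "\<And>\<gamma> b. bij_betw b {..<?d \<gamma>} (idx \<gamma>) \<Longrightarrow>
        proots (char_poly (enum_mat (?d \<gamma>) b (C_entry M \<gamma>))) = image_mset (ev \<gamma>) (mset_set {1..?d \<gamma>})"
    and trace: "\<And>\<gamma>. (\<Sum>j=1..?d \<gamma>. ev \<gamma> j) = (\<Sum>p\<in>idx \<gamma>. C_entry M \<gamma> p p)"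
    by blast+
  define J where "J = (SIGMA \<gamma>:Gamma_set. {1..?d \<gamma>})"
  have \<phi>_E: "\<phi> \<gamma> j \<in> E_space \<gamma>" if "j \<in> {1..?d \<gamma>}" for \<gamma> j
    unfolding span[symmetric] using that by (intro form.span_base imageI)
  have on_J: "form_inner M (\<phi> \<gamma> j) (\<phi> \<gamma>' k) = (if (\<gamma>, j) = (\<gamma>', k) then 1 else 0)"
    if "j \<in> {1..?d \<gamma>}" "k \<in> {1..?d \<gamma>'}" for \<gamma> \<gamma>' j k
    using that on[of j \<gamma> k] E_space_orthogonal[OF _ \<phi>_E \<phi>_E, of \<gamma> \<gamma>' j k]
    by (cases "\<gamma> = \<gamma>'") auto
  have S_J: "l2_inner M (S (\<phi> \<gamma> j)) (S (\<phi> \<gamma>' k)) = 0"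
    if "j \<in> {1..?d \<gamma>}" "k \<in> {1..?d \<gamma>'}" "(\<gamma>, j) \<noteq> (\<gamma>', k)" for \<gamma> \<gamma>' j k
    using that S_\<phi>[of j \<gamma> k] canonical_solution_E_space_orthogonal[OF S _ \<phi>_E \<phi>_E, of \<gamma> \<gamma>' j k]
    by (cases "\<gamma> = \<gamma>'") auto
  have norm_sq: "(l2_norm M (S (\<phi> \<gamma> j)))\<^sup>2 = ev \<gamma> j" if "j \<in> {1..?d \<gamma>}" for \<gamma> j
    using S_\<phi>[OF that that] unfolding l2_inner_self of_real_eq_iff by simp
  have norm: "l2_norm M (S (\<phi> \<gamma> j)) = sqrt (ev \<gamma> j)" if "j \<in> {1..?d \<gamma>}" for \<gamma> j
    unfolding norm_sq[OF that, symmetric] by (simp add: l2_norm_def integral_nonneg_AE)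
  \<comment> \<open>Each line is the span of a family with the one-element index set \<open>{()}\<close>.\<close>
  have "A2_form M = hilbert_sum M J (\<lambda>i. form.span ((\<lambda>_. \<phi> (fst i) (snd i)) ` {()}))"
  proof (rule A2_form_eq_hilbert_sum)
    fix i k i' k' assume "i \<in> J" "i' \<in> J"
    then show "form_inner M (\<phi> (fst i) (snd i)) (\<phi> (fst i') (snd i')) = (if i = i' \<and> k = (k' :: unit) then 1 else 0)"
      using on_J[of "snd i" "fst i" "snd i'" "fst i'"] by (auto simp: J_def split: if_splits)
  next
    fix i assume "i \<in> J"
    then have "\<phi> (fst i) (snd i) \<in> E_space (fst i)" by (intro \<phi>_E) (auto simp: J_def)
    then show "\<phi> (fst i) (snd i) \<in> poly_forms" using E_space_subset_poly_forms by blast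
  next
    fix \<alpha> :: "int ^ 'n" and j assume \<alpha>: "0 \<le> \<alpha>"
    let ?\<gamma> = "\<alpha> - unit_idx j"
    have "\<phi> ?\<gamma> ` {1..?d ?\<gamma>} \<subseteq> (\<Union>i\<in>J. form.span ((\<lambda>_. \<phi> (fst i) (snd i)) ` {()}))"
    proof
      fix \<omega> assume "\<omega> \<in> \<phi> ?\<gamma> ` {1..?d ?\<gamma>}"
      then obtain k where k: "\<omega> = \<phi> ?\<gamma> k" "k \<in> {1..?d ?\<gamma>}" by auto
      then have "(?\<gamma>, k) \<in> J" using sub_unit_idx_in_Gamma_set[OF \<alpha>] by (simp add: J_def)
      moreover have "\<omega> \<in> form.span ((\<lambda>_. \<phi> (fst (?\<gamma>, k)) (snd (?\<gamma>, k))) ` {()})"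
        unfolding k by (intro form.span_base) simp
      ultimately show "\<omega> \<in> (\<Union>i\<in>J. form.span ((\<lambda>_. \<phi> (fst i) (snd i)) ` {()}))" by (rule UN_I)
    qed
    then show "monomial_form \<alpha> j \<in> form.span (\<Union>i\<in>J. form.span ((\<lambda>_. \<phi> (fst i) (snd i)) ` {()}))"
      using form.span_mono monomial_form_in_E_space[OF \<alpha>, of j] span[of ?\<gamma>] by blast
  qed simp
  moreover have "(\<lambda>i. form.span ((\<lambda>_. \<phi> (fst i) (snd i)) ` {()})) = (\<lambda>(\<gamma>, j). form.span {\<phi> \<gamma> j})"
    by (rule ext) (simp add: case_prod_beta)
  ultimately have A2: "A2_form M = hilbert_sum M J (\<lambda>(\<gamma>, j). form.span {\<phi> \<gamma> j})" by (simp only:)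
  show ?thesis
    unfolding Let_def dim_E_space J_def[symmetric]
  proof (intro exI[of _ \<phi>] conjI ballI allI impI)
    fix \<gamma> :: "int ^ 'n"
    show "orthonormal M {1..?d \<gamma>} (\<phi> \<gamma>)" using on by (simp add: orthonormal_def)
    show "form.span (\<phi> \<gamma> ` {1..?d \<gamma>}) = E_space \<gamma>" by (rule span)
    show "(\<Sum>j=1..?d \<gamma>. (l2_norm M (S (\<phi> \<gamma> j)))\<^sup>2) = (\<Sum>p\<in>idx \<gamma>. C_entry M \<gamma> p p)"
      using norm_sq trace by simp
    show "(\<Sum>p\<in>idx \<gamma>. C_entry M \<gamma> p p) =
        (\<Sum>p\<in>idx \<gamma>. cc M (\<gamma> + unit_idx p) / cc M (\<gamma> + 2 *s unit_idx p) - cc M \<gamma> / cc M (\<gamma> + unit_idx p))"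
      by (intro sum.cong refl C_entry_diag)
    fix b assume b: "bij_betw b {..<?d \<gamma>} (idx \<gamma>)"
    show "image_mset (\<lambda>j. l2_norm M (S (\<phi> \<gamma> j))) (mset_set {1..?d \<gamma>}) =
        image_mset sqrt (proots (char_poly (enum_mat (?d \<gamma>) b (C_entry M \<gamma>))))"
      unfolding roots[OF b] multiset.map_comp using norm by (intro image_mset_cong) simp
  next
    show "orthonormal M J (\<lambda>(\<gamma>, j). \<phi> \<gamma> j)"
      unfolding orthonormal_def J_def using on_J by auto
    show "A2_form M = hilbert_sum M J (\<lambda>(\<gamma>, j). form.span {\<phi> \<gamma> j})" by (rule A2)
  next
    fix x assume "x \<in> J"
    then show "case x of (\<gamma>, j) \<Rightarrow> \<forall>(\<gamma>', k)\<in>J. (\<gamma>, j) \<noteq> (\<gamma>', k) \<longrightarrow>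
        l2_inner M (S (\<phi> \<gamma> j)) (S (\<phi> \<gamma>' k)) = 0"
      unfolding J_def by (auto intro!: S_J)
  qed
qed

end

theorem proposition11:
  fixes M :: "(complex ^ 'n::finite) measure"
  assumes sets_M: "sets M = sets borel"
    and norm_pos: "\<And>\<alpha>. 0 \<le> \<alpha> \<Longrightarrow> 0 < (\<integral>\<^sup>+z. ennreal ((cmod (monomial \<alpha> z))\<^sup>2) \<partial>M)"
    and norm_finite: "\<And>\<alpha>. 0 \<le> \<alpha> \<Longrightarrow> (\<integral>\<^sup>+z. ennreal ((cmod (monomial \<alpha> z))\<^sup>2) \<partial>M) < \<infinity>"
    and orthogonal: "\<And>\<alpha> \<beta>. 0 \<le> \<alpha> \<Longrightarrow> 0 \<le> \<beta> \<Longrightarrow> \<alpha> \<noteq> \<beta> \<Longrightarrow> l2_inner M (monomial \<alpha>) (monomial \<beta>) = 0"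
  shows
    "(\<exists>S. canonical_solution_operator M S) \<and>
     (\<forall>\<gamma>\<in>Gamma_set. E_space \<gamma> \<subseteq> A2_form M \<and> form.dim (E_space \<gamma>) \<in> {1, CARD('n)}) \<and>
     (\<forall>\<gamma>\<in>Gamma_set. \<forall>\<gamma>'\<in>Gamma_set. \<gamma> \<noteq> \<gamma>' \<longrightarrow> (\<forall>\<omega>\<in>E_space \<gamma>. \<forall>\<eta>\<in>E_space \<gamma>'. form_inner M \<omega> \<eta> = 0)) \<and>
     A2_form M = hilbert_sum M Gamma_set E_space \<and>
     (\<forall>S. canonical_solution_operator M S \<longrightarrow>
       (\<exists>\<phi>. let J = (SIGMA \<gamma>:Gamma_set. {1..form.dim (E_space \<gamma>)}) in
         (\<forall>\<gamma>\<in>Gamma_set. orthonormal M {1..form.dim (E_space \<gamma>)} (\<phi> \<gamma>) \<and>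
                   form.span (\<phi> \<gamma> ` {1..form.dim (E_space \<gamma>)}) = E_space \<gamma>) \<and>
         orthonormal M J (\<lambda>(\<gamma>, j). \<phi> \<gamma> j) \<and>
         A2_form M = hilbert_sum M J (\<lambda>(\<gamma>, j). form.span {\<phi> \<gamma> j}) \<and>
         (\<forall>(\<gamma>, j)\<in>J. \<forall>(\<gamma>', k)\<in>J. (\<gamma>, j) \<noteq> (\<gamma>', k) \<longrightarrow>
            l2_inner M (S (\<phi> \<gamma> j)) (S (\<phi> \<gamma>' k)) = 0) \<and>
         (\<forall>\<gamma>\<in>Gamma_set. \<forall>b. bij_betw b {..<card (idx \<gamma>)} (idx \<gamma>) \<longrightarrow>
            image_mset (\<lambda>j. l2_norm M (S (\<phi> \<gamma> j))) (mset_set {1..form.dim (E_space \<gamma>)}) =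
            image_mset sqrt (proots (char_poly (enum_mat (card (idx \<gamma>)) b (C_entry M \<gamma>))))) \<and>
         (\<forall>\<gamma>\<in>Gamma_set.
            (\<Sum>j=1..form.dim (E_space \<gamma>). (l2_norm M (S (\<phi> \<gamma> j)))\<^sup>2) = (\<Sum>p\<in>idx \<gamma>. C_entry M \<gamma> p p) \<and>
            (\<Sum>p\<in>idx \<gamma>. C_entry M \<gamma> p p) =
            (\<Sum>p\<in>idx \<gamma>. cc M (\<gamma> + unit_idx p) / cc M (\<gamma> + 2 *s unit_idx p) - cc M \<gamma> / cc M (\<gamma> + unit_idx p)))))"
proof -
  interpret orthogonal_monomials M
    by unfold_locales (fact sets_M norm_pos norm_finite orthogonal)+
  have dim: "form.dim (E_space \<gamma>) \<in> {1, CARD('n)}" if "\<gamma> \<in> Gamma_set" for \<gamma> :: "int ^ 'n"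
    unfolding dim_E_space by (rule card_idx[OF that])
  show ?thesis
    by (intro conjI ballI allI impI exists_canonical_solution_operator E_space_subset_A2_form dim
        E_space_orthogonal A2_form_eq_hilbert_sum_E_space exists_diagonalizing_basis)
qed

end
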